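(* Let $0\in\mathcal E\subset\mathbb C$ and let $\{\varphi_\varepsilon\}_{\varepsilon\in\mathcal E}$, $\varphi_\varepsilon:\bigcup_{j\ge1}D_{j,\varepsilon}\to D_\varepsilon\ni0$, be a convergent family of generalised Cantor repellers with uniform exponential tails, extensible over some topological disc $\hat D$ which compactly contains $D_0$. Denote by $P_\varepsilon$ the pressure function of $\varphi_\varepsilon$. Then, as $\varepsilon\to0$ in $\mathcal E$, $P_\varepsilon(t)\to P_0(t)$ uniformly for $t$ in a neighbourhood of $1$.
   Context: A generalised Cantor repeller is a map $\varphi:\bigcup_jD_j\to D$, where the $D_j$ form a finite or countably infinite collection of open non-degenerate topological discs (branch domains) with pairwise disjoint closures, each compactly contained in a topological disc $D\subset\mathbb C$, and $\varphi$ maps each $D_j$ biholomorphically onto $D$. It is extensible over a disc $\hat D\supset D$ if each branch of the inverse of $\varphi$ extends univalently to $\hat D$ with range in $\hat D$. Pressure: $P(t)=\lim_{n\to\infty}\frac1n\log\sum_{z\in\varphi^{-n}(0)}|D\varphi^n(z)|^{-t}$. Convergent family: $D_\varepsilon\to D_0$ as $\varepsilon\to0$ in $\mathcal E$; $\lim_{j_0\to\infty}\sup_{\varepsilon\in\mathcal E,\,j\ge j_0}\operatorname{diam}(D_{j,\varepsilon})=0$; and for each $j$, $D_{j,\varepsilon}\to D_{j,0}$ and $\varphi_\varepsilon\to\varphi_0$ uniformly on $D_{j,\varepsilon}\cap D_{j,0}$ as $\varepsilon\to0$ in $\mathcal E$. Convergence of domains is understood as Hausdorff convergence of closures. Uniform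 exponential tails: the domains are bounded and there are $C,\kappa>0$ independent of $\varepsilon$ such that, for all $s\in\mathbb R$, the sum of $\operatorname{diam}(D_{j,\varepsilon})$ over those $j$ with $\operatorname{diam}(D_{j,\varepsilon})<e^{-s}$ is less than $Ce^{-s\kappa}$. *)

theory Defs
  imports "HOL-Analysis.Analysis"
begin

definition topological_disc :: "complex set \<Rightarrow> bool" where
  "topological_disc U \<longleftrightarrow> open U \<and> U homeomorphic (ball 0 1 :: complex set)"

definition compactly_contained :: "complex set \<Rightarrow> complex set \<Rightarrow> bool" where
  "compactly_contained A B \<longleftrightarrow> compact (closure A) \<and> closure A \<subseteq> B"

definition biholomorphic_onto :: "(complex \<Rightarrow> complex) \<Rightarrow> complex set \<Rightarrow> complex set \<Rightarrow> bool" where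
  "biholomorphic_onto f A B \<longleftrightarrow>
     f holomorphic_on A \<and> bij_betw f A B \<and> inv_into A f holomorphic_on B"

(* The branch domains are Dj j for j in a non-empty set J of naturals, finite or infinite.
   The partial map phi is a total function whose values outside the branch domains are never used. *)
definition generalised_Cantor_repeller ::
  "nat set \<Rightarrow> (nat \<Rightarrow> complex set) \<Rightarrow> complex set \<Rightarrow> (complex \<Rightarrow> complex) \<Rightarrow> bool" where
  "generalised_Cantor_repeller J Dj D \<phi> \<longleftrightarrow>
     J \<noteq> {} \<and> topological_disc D \<and>
     (\<forall>j\<in>J. topological_disc (Dj j) \<and> compactly_contained (Dj j) D \<and>
             biholomorphic_onto \<phi> (Dj j) D) \<and>
     (\<forall>i\<in>J. \<forall>j\<in>J. i \<noteq> j \<longrightarrow> closure (Dj i) \<inter> closure (Dj j) = {})"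

definition extensible_over ::
  "nat set \<Rightarrow> (nat \<Rightarrow> complex set) \<Rightarrow> complex set \<Rightarrow> (complex \<Rightarrow> complex) \<Rightarrow> complex set \<Rightarrow> bool" where
  "extensible_over J Dj D \<phi> Dhat \<longleftrightarrow>
     topological_disc Dhat \<and> D \<subseteq> Dhat \<and>
     (\<forall>j\<in>J. \<exists>\<psi>. \<psi> holomorphic_on Dhat \<and> inj_on \<psi> Dhat \<and> \<psi> ` Dhat \<subseteq> Dhat \<and>
                  (\<forall>w\<in>D. \<psi> w = inv_into (Dj j) \<phi> w))"

(* The preimage of w under the n-th iterate of the partial map phi with domain U. *)
definition iterate_preimage ::
  "complex set \<Rightarrow> (complex \<Rightarrow> complex) \<Rightarrow> nat \<Rightarrow> complex \<Rightarrow> complex set" where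
  "iterate_preimage U \<phi> n w = {z. (\<forall>k<n. (\<phi> ^^ k) z \<in> U) \<and> (\<phi> ^^ n) z = w}"

definition ext_ln :: "ennreal \<Rightarrow> ereal" where
  "ext_ln x = (if x = 0 then - \<infinity> else if x = \<infinity> then \<infinity> else ereal (ln (enn2real x)))"

definition pressure_seq ::
  "complex set \<Rightarrow> (complex \<Rightarrow> complex) \<Rightarrow> real \<Rightarrow> nat \<Rightarrow> ereal" where
  "pressure_seq U \<phi> t n =
     ereal (1 / real n) *
     ext_ln (\<Sum>\<^sub>\<infinity>z\<in>iterate_preimage U \<phi> n 0. ennreal (norm (deriv (\<phi> ^^ n) z) powr (- t)))"

(* The pressure may be infinite; the value is meaningful only if the sequence converges in ereal. *)
definition pressure :: "complex set \<Rightarrow> (complex \<Rightarrow> complex) \<Rightarrow> real \<Rightarrow> ereal" where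
  "pressure U \<phi> t = lim (pressure_seq U \<phi> t)"

(* Hausdorff distance, intended for non-empty sets (infdist to the empty set is 0). *)
definition hausdorff_edist :: "complex set \<Rightarrow> complex set \<Rightarrow> ennreal" where
  "hausdorff_edist A B =
     max (SUP x\<in>A. ennreal (infdist x B)) (SUP y\<in>B. ennreal (infdist y A))"

definition domains_converge :: "complex set \<Rightarrow> (complex \<Rightarrow> complex set) \<Rightarrow> bool" where
  "domains_converge E A \<longleftrightarrow>
     ((\<lambda>\<epsilon>. hausdorff_edist (closure (A \<epsilon>)) (closure (A 0))) \<longlongrightarrow> 0) (at 0 within E)"

definition convergent_family ::
  "complex set \<Rightarrow> nat set \<Rightarrow> (complex \<Rightarrow> nat \<Rightarrow> complex set) \<Rightarrow> (complex \<Rightarrow> complex set)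
   \<Rightarrow> (complex \<Rightarrow> complex \<Rightarrow> complex) \<Rightarrow> bool" where
  "convergent_family E J Dj D \<phi> \<longleftrightarrow>
     domains_converge E D \<and>
     (\<lambda>j0. SUP (\<epsilon>, j)\<in>E \<times> {j\<in>J. j \<ge> j0}. ennreal (diameter (Dj \<epsilon> j))) \<longlonglongrightarrow> 0 \<and>
     (\<forall>j\<in>J. domains_converge E (\<lambda>\<epsilon>. Dj \<epsilon> j) \<and>
        (\<forall>\<eta>>0. \<forall>\<^sub>F \<epsilon> in at 0 within E. \<forall>z\<in>Dj \<epsilon> j \<inter> Dj 0 j. dist (\<phi> \<epsilon> z) (\<phi> 0 z) < \<eta>))"

definition uniform_exponential_tails ::
  "complex set \<Rightarrow> nat set \<Rightarrow> (complex \<Rightarrow> nat \<Rightarrow> complex set) \<Rightarrow> (complex \<Rightarrow> complex set) \<Rightarrow> bool" where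
  "uniform_exponential_tails E J Dj D \<longleftrightarrow>
     (\<forall>\<epsilon>\<in>E. bounded (D \<epsilon>)) \<and>
     (\<exists>C>0. \<exists>\<kappa>>0. \<forall>\<epsilon>\<in>E. \<forall>s::real.
        (\<Sum>\<^sub>\<infinity>j\<in>{j\<in>J. diameter (Dj \<epsilon> j) < exp (- s)}. ennreal (diameter (Dj \<epsilon> j)))
          < ennreal (C * exp (- s * \<kappa>)))"

end

theory Submission
  imports Defs "HOL-Complex_Analysis.Complex_Analysis"
begin

text \<open>
  Write \<open>\<psi>\<^sub>j\<close> for the univalent extensions of the inverse branches to the large disc \<open>S\<close>
  (\<open>Dhat\<close> in the theorem). The sum over the \<open>n\<close>-th preimages of \<open>x\<close> is the value at \<open>x\<close> of the \<open>n\<close>-th iterate of the transfer operator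
  \<open>h \<mapsto> (\<Sum>j. \<bar>\<psi>\<^sub>j'\<bar>\<^sup>t \<cdot> (h \<circ> \<psi>\<^sub>j))\<close> on the constant \<open>1\<close> (\<open>partition_sum\<close>, \<open>infsum_iterate_preimage\<close>).

  The engine is bounded distortion: all univalent functions on \<open>S\<close> have comparable derivatives at
  any two points of a fixed compact subset (\<open>univalent_distortion_compact\<close>). Every composition of
  branches is univalent on \<open>S\<close>, so the partition sums at two points of the compact set differ by at most
  a factor \<open>M\<^sup>t\<close>, whatever \<open>n\<close> is (\<open>partition_sum_distortion\<close>). Therefore the logarithms of the partition
  sums at \<open>0\<close> are additive in \<open>n\<close> up to a constant, the limit defining the pressure exists, and
  \<open>1/n\<close> times the logarithm of the \<open>n\<close>-th sum is within \<open>O(1/n)\<close> of the pressure (\<open>pressure_seq_tendsto\<close>).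
  The constant does not depend on \<open>\<epsilon>\<close>, since for small \<open>\<epsilon>\<close> all the domains lie in one compact set. The
  pressure is thus a uniform limit of functions of \<open>(\<epsilon>, t)\<close>, and it is enough to show, for each fixed \<open>n\<close>,
  that the \<open>n\<close>-th partition sum is continuous at \<open>\<epsilon> = 0\<close>, jointly with \<open>t\<close> and the base point.

  This has two ingredients. First, each single branch converges: the branches form a normal family, and
  a limit of a subsequence must agree with \<open>\<psi>\<^sub>j\<close> for \<open>\<epsilon> = 0\<close> on \<open>D 0\<close>, because \<open>\<phi>\<close> converges on the
  branch domain (\<open>inverse_branch_limit\<close>). Hausdorff convergence of closures allows the domains to be slit wildly; this does no harm because everything is carried out on the fixed disc \<open>S\<close>.
  Secondly, the contributions of the branches with large index are uniformly small: distortion gives \<open>\<bar>\<psi>\<^sub>j'\<bar> \<le> const \<cdot> diam D\<^sub>j\<close> (\<open>univalent_deriv_le_displacement\<close>), and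
  exponential tails with rate \<open>\<kappa>\<close> make the sum of \<open>(diam D\<^sub>j)\<^sup>t\<close> converge uniformly for \<open>t\<close> slightly below \<open>1\<close>
  (\<open>nn_integral_power_tail\<close>). Uniformity in \<open>t\<close> then follows by compactness of an interval around \<open>1\<close>.
\<close>

section \<open>Distortion of univalent functions\<close>

text \<open>
  The qualitative form of Koebe's theorem used here comes from Schottky's theorem. A univalent \<open>f\<close> that omits
  \<open>\<beta>\<close> has a square root \<open>h\<close> of \<open>f - \<beta>\<close>; injectivity of \<open>f\<close> makes \<open>h\<close> omit not only \<open>0\<close> but also
  \<open>- h(a)\<close>. After normalisation \<open>h\<close> omits \<open>0\<close> and \<open>1\<close>.\<close>
lemma univalent_omitted_value_bound:
  "\<exists>S\<ge>1. \<forall>f a R \<beta> x. R > 0 \<longrightarrow> f holomorphic_on ball a R \<longrightarrow> inj_on f (ball a R) \<longrightarrow> \<beta> \<notin> f ` ball a R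
      \<longrightarrow> dist x a \<le> R / 4 \<longrightarrow> norm (f x - \<beta>) \<le> S * norm (f a - \<beta>)"
proof -
  \<comment> \<open>The bound of Schottky at radius one half, for a function of modulus \<open>1\<close> at the centre.\<close>
  define T where "T = exp (pi * exp (pi * (2 + 2 * 1 + 12 * (1/2) / (1 - 1/2))))"
  have T1: "T \<ge> 1" unfolding T_def by simp
  show ?thesis
  proof (intro exI[of _ "T^2"] conjI allI impI)
    show "1 \<le> T\<^sup>2" using T1 by simp
    fix f :: "complex \<Rightarrow> complex" and a \<beta> x :: complex and R :: real
    assume R: "R > 0" and hol: "f holomorphic_on ball a R" and inj: "inj_on f (ball a R)"
      and \<beta>: "\<beta> \<notin> f ` ball a R" and x: "dist x a \<le> R / 4"
    have "simply_connected (ball a R)" by (simp add: convex_imp_simply_connected)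
    moreover have "(\<lambda>z. f z - \<beta>) holomorphic_on ball a R" by (intro holomorphic_intros hol)
    moreover have "\<forall>z\<in>ball a R. f z - \<beta> \<noteq> 0" using \<beta> by auto
    ultimately obtain h where h: "h holomorphic_on ball a R" "\<forall>z\<in>ball a R. f z - \<beta> = (h z)^2"
      using simply_connected_eq_holomorphic_sqrt[OF open_ball, of a R] by blast
    have h0: "h z \<noteq> 0" if "z \<in> ball a R" for z using h(2) \<beta> that by force
    have aB: "a \<in> ball a R" using R by simp
    have hneg: "h z \<noteq> - h a" if z: "z \<in> ball a R" for z
    proof
      assume *: "h z = - h a"
      hence "f z = f a" using h(2) z aB by (metis diff_add_cancel power2_minus)
      hence "z = a" using inj z aB by (auto dest: inj_onD)
      with * h0[OF aB] show False by simp
    qed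
    define g where "g = (\<lambda>w. - h (a + of_real (R/2) * w) / h a)"
    have inB: "a + of_real (R/2) * w \<in> ball a R" if "w \<in> cball 0 1" for w
    proof -
      have "norm (of_real (R/2) * w) \<le> R/2 * 1"
        unfolding norm_mult using R that by (intro mult_mono) auto
      also have "\<dots> < R" using R by simp
      finally show ?thesis by (simp add: dist_norm)
    qed
    have "(h \<circ> (\<lambda>w. a + of_real (R/2) * w)) holomorphic_on cball 0 1"
      by (rule holomorphic_on_compose_gen[OF _ h(1)]) (use inB in \<open>auto intro!: holomorphic_intros\<close>)
    then have g: "g holomorphic_on cball 0 1"
      unfolding g_def using h0[OF aB] by (auto intro!: holomorphic_intros simp: o_def)
    define w where "w = (x - a) / of_real (R/2)"
    have "of_real (R/2) \<noteq> (0::complex)" using R by simp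
    then have "of_real (R/2) * w = x - a"
      unfolding w_def by (metis nonzero_mult_div_cancel_left times_divide_eq_right)
    then have xw: "x = a + of_real (R/2) * w" by (metis add.commute diff_add_cancel)
    have nw: "norm w \<le> 1/2"
    proof -
      have "norm w = norm (x - a) / (R/2)"
        unfolding w_def norm_divide norm_of_real using R by simp
      also have "\<dots> \<le> (R/4) / (R/2)"
        using x R by (intro divide_right_mono) (auto simp: dist_norm)
      finally show ?thesis using R by simp
    qed
    have "norm (g w) \<le> T" unfolding T_def
    proof (rule Schottky[OF g])
      show "norm (g 0) \<le> 1" unfolding g_def using h0[OF aB] by (simp add: norm_divide)
      show "\<not> (g z = 0 \<or> g z = 1)" if "z \<in> cball 0 1" for z
        using h0[OF aB] h0[OF inB[OF that]] hneg[OF inB[OF that]] unfolding g_def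
        by (auto simp: field_simps)
          (metis minus_minus)
    qed (use nw in auto)
    then have "norm (h x) \<le> T * norm (h a)"
      unfolding g_def xw[symmetric] using h0[OF aB] by (simp add: norm_divide field_simps)
    then have "norm (h x) ^ 2 \<le> (T * norm (h a)) ^ 2" by (intro power_mono) auto
    moreover have "x \<in> ball a R" using x R by (simp add: dist_commute)
    ultimately show "norm (f x - \<beta>) \<le> T\<^sup>2 * norm (f a - \<beta>)"
      using h(2) aB by (simp add: norm_power power_mult_distrib)
  qed
qed

lemma Cauchy_deriv_bound:
  assumes "f holomorphic_on ball a R" "0 < r" "r < R" and b: "\<And>x. norm (x - a) = r \<Longrightarrow> norm (f x - c) \<le> B"
  shows "norm (deriv f a) \<le> B / r"
proof -
  have sub: "cball a r \<subseteq> ball a R" "ball a r \<subseteq> ball a R" using assms by auto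
  have h: "(\<lambda>x. f x - c) holomorphic_on ball a R" by (intro holomorphic_intros assms)
  have "norm ((deriv ^^ 1) (\<lambda>x. f x - c) a) \<le> fact 1 * B / r ^ 1"
    by (rule Cauchy_inequality)
      (use assms sub h b in \<open>auto intro: holomorphic_on_subset holomorphic_on_imp_continuous_on simp: norm_minus_commute\<close>)
  moreover have "deriv (\<lambda>x. f x - c) a = deriv f a"
  proof -
    have "f field_differentiable at a"
      using assms by (intro holomorphic_on_imp_differentiable_at) auto
    then show ?thesis by (simp add: deriv_diff)
  qed
  ultimately show ?thesis by simp
qed

text \<open>The image of \<open>ball a R\<close> contains a disc about \<open>f(a)\<close> of radius comparable to \<open>R \<bar>f'(a)\<bar>\<close>; compare
  Koebe's quarter theorem. It is the previous bound combined with Cauchy's inequality.\<close>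
lemma univalent_omitted_value_distance:
  "\<exists>C>0. \<forall>f a R \<beta>. R > 0 \<longrightarrow> f holomorphic_on ball a R \<longrightarrow> inj_on f (ball a R) \<longrightarrow> \<beta> \<notin> f ` ball a R
      \<longrightarrow> R * norm (deriv f a) \<le> C * norm (f a - \<beta>)"
proof -
  obtain S where S: "S \<ge> 1" "\<And>f a R \<beta> x. \<lbrakk>R > 0; f holomorphic_on ball a R; inj_on f (ball a R); \<beta> \<notin> f ` ball a R;
      dist x a \<le> R / 4\<rbrakk> \<Longrightarrow> norm (f x - \<beta>) \<le> S * norm (f a - \<beta>)"
    using univalent_omitted_value_bound by meson
  show ?thesis
  proof (intro exI[of _ "4 * S"] conjI allI impI)
    show "0 < 4 * S" using S by simp
    fix f :: "complex \<Rightarrow> complex" and a \<beta> :: complex and R :: real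
    assume R: "R > 0" and hol: "f holomorphic_on ball a R" and inj: "inj_on f (ball a R)"
      and \<beta>: "\<beta> \<notin> f ` ball a R"
    have "norm (deriv f a) \<le> (S * norm (f a - \<beta>)) / (R/4)"
      by (rule Cauchy_deriv_bound[OF hol, of _ \<beta>]) (use R S(2)[OF R hol inj \<beta>] in \<open>auto simp: dist_norm\<close>)
    then show "R * norm (deriv f a) \<le> 4 * S * norm (f a - \<beta>)" using R by (simp add: field_simps)
  qed
qed

text \<open>If the image contained the whole disc of radius \<open>3 R \<bar>f'(a)\<bar>\<close>, then Cauchy's inequality for the inverse
  function on the disc of radius \<open>2 R \<bar>f'(a)\<bar>\<close> would force its derivative at \<open>f(a)\<close> below \<open>1 / \<bar>f'(a)\<bar>\<close>.\<close>
lemma univalent_omits_nearby_value: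
  assumes R: "R > 0" and hol: "f holomorphic_on ball a R" and inj: "inj_on f (ball a R)"
  shows "\<exists>\<beta>. \<beta> \<notin> f ` ball a R \<and> norm (f a - \<beta>) \<le> 3 * R * norm (deriv f a)"
proof (rule ccontr)
  assume "\<not> ?thesis"
  then have sub: "\<beta> \<in> f ` ball a R" if "norm (f a - \<beta>) \<le> 3 * R * norm (deriv f a)" for \<beta> using that by auto
  define d where "d = R * norm (deriv f a)"
  have d0: "deriv f a \<noteq> 0" by (rule holomorphic_injective_imp_regular[OF hol _ inj]) (use R in auto)
  then have d: "d > 0" unfolding d_def using R by simp
  obtain g where g: "g holomorphic_on f ` ball a R"
    "\<And>z. z \<in> ball a R \<Longrightarrow> deriv f z * deriv g (f z) = 1" "\<And>z. z \<in> ball a R \<Longrightarrow> g (f z) = z"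
    using holomorphic_has_inverse[OF hol _ inj] by auto
  have bs: "ball (f a) (3 * d) \<subseteq> f ` ball a R"
    using sub unfolding d_def by (auto simp: dist_norm mult.assoc)
  have "norm (deriv g (f a)) \<le> R / (2 * d)"
  proof (rule Cauchy_deriv_bound[OF holomorphic_on_subset[OF g(1) bs], of _ a])
    fix x assume "norm (x - f a) = 2 * d"
    then have "x \<in> f ` ball a R" using bs d by (auto simp: dist_norm norm_minus_commute)
    then obtain z where "z \<in> ball a R" "x = f z" by auto
    then show "norm (g x - a) \<le> R" using g(3) by (auto simp: dist_norm norm_minus_commute)
  qed (use d in auto)
  moreover have "norm (deriv f a) * norm (deriv g (f a)) = 1"
    using g(2)[of a] R by (simp flip: norm_mult)
  ultimately have "1 \<le> norm (deriv f a) * (R / (2 * d))"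
    by (metis mult_left_mono norm_ge_zero)
  then show False using R d0 unfolding d_def by (simp add: field_simps)
qed

text \<open>An omitted value near \<open>f(a)\<close> turns the growth bound into one in terms of \<open>f'(a)\<close> alone. The two derivative
  bounds are the same estimate with the roles of \<open>a\<close> and \<open>x\<close> exchanged, since \<open>ball x (R/2)\<close> still lies in
  \<open>ball a R\<close>.\<close>
lemma univalent_local_distortion:
  "\<exists>C\<ge>1. \<forall>f a R x. R > 0 \<longrightarrow> f holomorphic_on ball a R \<longrightarrow> inj_on f (ball a R) \<longrightarrow> dist x a \<le> R / 16 \<longrightarrow>
      norm (deriv f x) \<le> C * norm (deriv f a) \<and> norm (deriv f a) \<le> C * norm (deriv f x) \<and>
      norm (f x - f a) \<le> C * R * norm (deriv f a)"
proof -
  obtain S where S: "S \<ge> 1" "\<And>f a R \<beta> x. \<lbrakk>R > 0; f holomorphic_on ball a R; inj_on f (ball a R); \<beta> \<notin> f ` ball a R;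
      dist x a \<le> R / 4\<rbrakk> \<Longrightarrow> norm (f x - \<beta>) \<le> S * norm (f a - \<beta>)"
    using univalent_omitted_value_bound by meson
  define C where "C = 3 * (S + 1)"
  have grow: "norm (f x - f a) \<le> C * R * norm (deriv f a)"
    if R: "R > 0" and hol: "f holomorphic_on ball a R" and inj: "inj_on f (ball a R)" and x: "dist x a \<le> R/4"
    for f a R x
  proof -
    obtain \<beta> where \<beta>: "\<beta> \<notin> f ` ball a R" "norm (f a - \<beta>) \<le> 3 * R * norm (deriv f a)"
      using univalent_omits_nearby_value[OF R hol inj] by auto
    have "norm (f x - f a) = norm ((f x - \<beta>) - (f a - \<beta>))" by simp
    also have "\<dots> \<le> norm (f x - \<beta>) + norm (f a - \<beta>)" by (rule norm_triangle_ineq4)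
    also have "\<dots> \<le> (S + 1) * norm (f a - \<beta>)"
      using S(2)[OF R hol inj \<beta>(1) x] by (simp add: algebra_simps)
    also have "\<dots> \<le> (S + 1) * (3 * R * norm (deriv f a))"
      using \<beta>(2) S(1) by (intro mult_left_mono) auto
    finally show ?thesis unfolding C_def by (simp add: algebra_simps)
  qed
  have der: "norm (deriv f x) \<le> 16 * C * norm (deriv f a)"
    if R: "R > 0" and hol: "f holomorphic_on ball a R" and inj: "inj_on f (ball a R)" and x: "dist x a \<le> R/8"
    for f a R x
  proof -
    have sub: "ball x (R/8) \<subseteq> ball a R"
      using x R by (auto simp: dist_commute intro: dist_triangle_le)
        (smt (verit) dist_commute dist_triangle)
    have "norm (deriv f x) \<le> (C * R * norm (deriv f a)) / (R/16)"
    proof (rule Cauchy_deriv_bound[OF holomorphic_on_subset[OF hol sub], of _ "f a"])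
      fix y assume "norm (y - x) = R/16"
      then have "dist y a \<le> R/4" using x R dist_triangle[of y a x] by (simp add: dist_norm)
      then show "norm (f y - f a) \<le> C * R * norm (deriv f a)" by (rule grow[OF R hol inj])
    qed (use R in auto)
    then show ?thesis using R by simp
  qed
  show ?thesis
  proof (intro exI[of _ "16 * C"] conjI allI impI)
    show "1 \<le> 16 * C" unfolding C_def using S(1) by simp
    fix f :: "complex \<Rightarrow> complex" and a x :: complex and R :: real
    assume R: "R > 0" and hol: "f holomorphic_on ball a R" and inj: "inj_on f (ball a R)"
      and x: "dist x a \<le> R / 16"
    show "norm (deriv f x) \<le> 16 * C * norm (deriv f a)" by (rule der[OF R hol inj]) (use x R in auto)
    have sub: "ball x (R/2) \<subseteq> ball a R"
      using x R by auto (smt (verit) dist_commute dist_triangle)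
    show "norm (deriv f a) \<le> 16 * C * norm (deriv f x)"
      by (rule der[OF _ holomorphic_on_subset[OF hol sub] inj_on_subset[OF inj sub]])
        (use x R in \<open>auto simp: dist_commute\<close>)
    have "norm (f x - f a) \<le> C * R * norm (deriv f a)" by (rule grow[OF R hol inj]) (use x R in auto)
    also have "\<dots> \<le> 16 * C * R * norm (deriv f a)"
      using R S(1) unfolding C_def by (intro mult_right_mono) auto
    finally show "norm (f x - f a) \<le> 16 * C * R * norm (deriv f a)" .
  qed
qed


text \<open>Being comparable for all univalent functions at once is an equivalence relation on the points of \<open>S\<close>, up to
  changing the constant, and nearby points are related; connectedness and compactness do the rest.\<close>
lemma univalent_distortion_compact:
  assumes S: "open S" "connected S" and K: "compact K" "K \<subseteq> S"
  shows "\<exists>M\<ge>1. \<forall>f. f holomorphic_on S \<longrightarrow> inj_on f S \<longrightarrow> (\<forall>x\<in>K. \<forall>y\<in>K.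
      norm (deriv f x) \<le> M * norm (deriv f y) \<and> norm (f x - f y) \<le> M * norm (deriv f y))"
proof (cases "K = {}")
  case False
  define R where "R M x y \<longleftrightarrow> (\<forall>f. f holomorphic_on S \<longrightarrow> inj_on f S \<longrightarrow>
      norm (deriv f x) \<le> M * norm (deriv f y) \<and> norm (deriv f y) \<le> M * norm (deriv f x) \<and>
      norm (f x - f y) \<le> M * norm (deriv f y))" for M :: real and x y
  have R_mono: "R M' x y" if "R M x y" "M \<le> M'" for M M' x y
    using that unfolding R_def by (meson mult_right_mono norm_ge_zero order_trans)
  have R_sym: "R (M * M) y x" if "R M x y" "M \<ge> 1" for M x y
    unfolding R_def
  proof (intro allI impI)
    fix f assume f: "f holomorphic_on S" "inj_on f S"
    have a: "norm (deriv f x) \<le> M * norm (deriv f y)" "norm (deriv f y) \<le> M * norm (deriv f x)"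
       "norm (f x - f y) \<le> M * norm (deriv f y)" using that f unfolding R_def by auto
    have "M * 1 \<le> M * M" using that by (intro mult_left_mono) auto
    then have "M * norm (deriv f z) \<le> M * M * norm (deriv f z)" for z by (intro mult_right_mono) auto
    moreover have "M * norm (deriv f y) \<le> M * (M * norm (deriv f x))"
      using a that by (intro mult_left_mono) auto
    ultimately show "norm (deriv f y) \<le> M * M * norm (deriv f x) \<and>
         norm (deriv f x) \<le> M * M * norm (deriv f y) \<and> norm (f y - f x) \<le> M * M * norm (deriv f x)"
      using a norm_minus_commute[of "f x" "f y"] by (smt (verit) mult.assoc)
  qed
  have R_trans: "R (2 * M * M) x z" if "R M x y" "R M y z" "M \<ge> 1" for M x y z
    unfolding R_def
  proof (intro allI impI)
    fix f assume f: "f holomorphic_on S" "inj_on f S"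
    have a: "norm (deriv f x) \<le> M * norm (deriv f y)" "norm (deriv f y) \<le> M * norm (deriv f x)"
       "norm (f x - f y) \<le> M * norm (deriv f y)" using that f unfolding R_def by auto
    have b: "norm (deriv f y) \<le> M * norm (deriv f z)" "norm (deriv f z) \<le> M * norm (deriv f y)"
       "norm (f y - f z) \<le> M * norm (deriv f z)" using that f unfolding R_def by auto
    have m: "M * norm (deriv f y) \<le> M * (M * norm (deriv f z))" "M * norm (deriv f y) \<le> M * (M * norm (deriv f x))"
      using a b that by (auto intro!: mult_left_mono)
    have "M * 1 \<le> M * M" using that by (intro mult_left_mono) auto
    then have m2: "M * norm (deriv f z) \<le> M * M * norm (deriv f z)" by (intro mult_right_mono) auto
    have m3: "M * M * norm (deriv f w) \<ge> 0" for w using that by auto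
    have t: "norm (f x - f z) \<le> norm (f x - f y) + norm (f y - f z)"
      using norm_triangle_ineq[of "f x - f y" "f y - f z"] by simp
    show "norm (deriv f x) \<le> 2 * M * M * norm (deriv f z) \<and>
         norm (deriv f z) \<le> 2 * M * M * norm (deriv f x) \<and> norm (f x - f z) \<le> 2 * M * M * norm (deriv f z)"
      using a b m m2 m3[of x] m3[of z] t by (simp add: mult.assoc)
  qed
  obtain C where C: "C \<ge> 1" "\<And>f a r x. \<lbrakk>r > 0; f holomorphic_on ball a r; inj_on f (ball a r); dist x a \<le> r / 16\<rbrakk> \<Longrightarrow>
      norm (deriv f x) \<le> C * norm (deriv f a) \<and> norm (deriv f a) \<le> C * norm (deriv f x) \<and>
      norm (f x - f a) \<le> C * r * norm (deriv f a)"
    using univalent_local_distortion by meson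
  have R_local: "\<exists>r>0. \<exists>M\<ge>1. ball a r \<subseteq> S \<and> (\<forall>x\<in>ball a r. R M x a)" if a: "a \<in> S" for a
  proof -
    obtain r where r: "r > 0" "ball a r \<subseteq> S" using S a by (meson openE)
    have "R (C * max 1 r) x a" if "x \<in> ball a (r/16)" for x
      unfolding R_def
    proof (intro allI impI)
      fix f assume f: "f holomorphic_on S" "inj_on f S"
      have 1: "norm (deriv f x) \<le> C * norm (deriv f a) \<and> norm (deriv f a) \<le> C * norm (deriv f x) \<and>
        norm (f x - f a) \<le> C * r * norm (deriv f a)"
        by (rule C(2)[OF r(1)]) (use r f that in \<open>auto intro: holomorphic_on_subset inj_on_subset simp: dist_commute\<close>)
      have "C * 1 \<le> C * max 1 r" "C * r \<le> C * max 1 r" using C by (auto intro!: mult_left_mono)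
      then have "C * norm z \<le> C * max 1 r * norm z" "C * r * norm z \<le> C * max 1 r * norm z" for z :: complex
        by (auto intro!: mult_right_mono)
      with 1 show "norm (deriv f x) \<le> C * max 1 r * norm (deriv f a) \<and>
          norm (deriv f a) \<le> C * max 1 r * norm (deriv f x) \<and> norm (f x - f a) \<le> C * max 1 r * norm (deriv f a)"
        by (meson order_trans)
    qed
    moreover have "C * max 1 r \<ge> 1" using C by (metis max.cobounded1 mult_mono' mult_1 zero_le_one)
    moreover have "ball a (r/16) \<subseteq> ball a r" using r by auto
    ultimately show ?thesis using r by (intro exI[of _ "r/16"]) (auto intro!: exI[of _ "C * max 1 r"])
  qed
  \<comment> \<open>All points of \<open>K\<close> are compared with one base point.\<close>
  obtain b where b: "b \<in> K" using False by auto
  have global: "\<exists>M\<ge>1. R M a b" if a: "a \<in> S" for a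
  proof (rule connected_equivalence_relation[OF S(2), where R = "\<lambda>x y. \<exists>M\<ge>1. R M x y"])
    show "a \<in> S" "b \<in> S" using a b K by auto
    show "\<exists>M\<ge>1. R M y x" if "\<exists>M\<ge>1. R M x y" for x y
      using that R_sym by (metis mult_mono' mult_1 zero_le_one)
    show "\<exists>M\<ge>1. R M x z" if xy: "\<exists>M\<ge>1. R M x y" and yz: "\<exists>M\<ge>1. R M y z" for x y z
    proof -
      obtain M M' where M: "M \<ge> 1" "R M x y" "M' \<ge> 1" "R M' y z" using xy yz by auto
      then have "R (max M M') x y" "R (max M M') y z" by (auto intro: R_mono)
      then have "R (2 * max M M' * max M M') x z" using M by (intro R_trans) auto
      moreover have "1 * 1 \<le> (2 * max M M') * max M M'" using M by (intro mult_mono) auto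
      ultimately show ?thesis by auto
    qed
    show "\<exists>T. openin (top_of_set S) T \<and> x \<in> T \<and> (\<forall>y\<in>T. \<exists>M\<ge>1. R M x y)" if x: "x \<in> S" for x
    proof -
      obtain r M where r: "r > 0" "M \<ge> 1" "ball x r \<subseteq> S" "\<forall>y\<in>ball x r. R M y x" using R_local[OF x] by auto
      have "1 * 1 \<le> M * M" using r by (intro mult_mono) auto
      with r show ?thesis using S(1)
        by (intro exI[of _ "ball x r"]) (auto intro!: exI[of _ "M * M"] R_sym simp: openin_open_eq)
    qed
  qed
  have "\<exists>r>0. \<exists>M\<ge>1. \<forall>x\<in>ball a r. R M x b" if a: "a \<in> S" for a
  proof -
    obtain r M where r: "r > 0" "M \<ge> 1" "\<forall>x\<in>ball a r. R M x a" using R_local[OF a] by auto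
    obtain M' where M': "M' \<ge> 1" "R M' a b" using global[OF a] by auto
    have "R (2 * max M M' * max M M') x b" if "x \<in> ball a r" for x
    proof (rule R_trans)
      show "R (max M M') x a" "R (max M M') a b" using R_mono[OF _ max.cobounded1] R_mono[OF _ max.cobounded2] r(3) M'(2) that by blast+
    qed (use r in auto)
    moreover have "1 * 1 \<le> (2 * max M M') * max M M'" using r by (intro mult_mono) auto
    ultimately show ?thesis using r(1) by (metis mult_1)
  qed
  then obtain r M where rM: "\<And>a. a \<in> S \<Longrightarrow> r a > 0" "\<And>a. a \<in> S \<Longrightarrow> M a \<ge> 1"
    "\<And>a x. \<lbrakk>a \<in> S; x \<in> ball a (r a)\<rbrakk> \<Longrightarrow> R (M a) x b" by metis
  obtain F where F: "F \<subseteq> K" "finite F" "K \<subseteq> (\<Union>a\<in>F. ball a (r a))"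
    by (rule compactE_image[OF K(1), of K "\<lambda>a. ball a (r a)"])
      (use rM(1) K(2) in \<open>force+\<close>)
  define N where "N = Max (insert 1 (M ` F))"
  have N: "N \<ge> 1" "\<And>a. a \<in> F \<Longrightarrow> M a \<le> N" unfolding N_def using F(2) by auto
  have RN: "R N x b" if x: "x \<in> K" for x
  proof -
    obtain a where a: "a \<in> F" "x \<in> ball a (r a)" using F x by auto
    then show ?thesis using rM(3)[of a x] N(2)[OF a(1)] F(1) K(2) R_mono by blast
  qed
  define L where "L = 2 * (N * N) * (N * N)"
  have NN: "1 * 1 \<le> N * N" using N by (intro mult_mono) auto
  then have "1 * N \<le> N * N" using N by (intro mult_right_mono) auto
  have "1 \<le> (2 * (N * N)) * (N * N)" using mult_mono[of 1 "2 * (N*N)" 1 "N * N"] NN by auto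
  then have "L \<ge> 1" unfolding L_def .
  moreover have "R L x y" if "x \<in> K" "y \<in> K" for x y
    unfolding L_def
  proof (rule R_trans)
    show "R (N * N) x b" using RN[OF that(1)] \<open>1 * N \<le> N * N\<close> by (auto intro: R_mono)
    show "R (N * N) b y" using RN[OF that(2)] N by (auto intro: R_sym)
  qed (use NN in auto)
  ultimately show ?thesis unfolding R_def by blast
qed auto

text \<open>The point \<open>p\<close> lies outside \<open>ball a r\<close>, hence \<open>f p\<close> is a value that \<open>f\<close> omits on this ball. This bounds
  \<open>f'(a)\<close> by the diameter of \<open>f ` A\<close> for any \<open>A \<subseteq> S\<close> containing \<open>a\<close> and a point at distance at least \<open>r\<close>, even if \<open>A\<close>
  contains no disc of a definite size.\<close>
lemma univalent_deriv_le_displacement: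
  assumes "ball a r \<subseteq> S" "r > 0"
  shows "\<exists>C>0. \<forall>f p. f holomorphic_on S \<longrightarrow> inj_on f S \<longrightarrow> p \<in> S - ball a r \<longrightarrow>
      norm (deriv f a) \<le> C * norm (f p - f a)"
proof -
  obtain C where C: "C > 0" "\<And>f a R \<beta>. \<lbrakk>R > 0; f holomorphic_on ball a R; inj_on f (ball a R); \<beta> \<notin> f ` ball a R\<rbrakk>
      \<Longrightarrow> R * norm (deriv f a) \<le> C * norm (f a - \<beta>)"
    using univalent_omitted_value_distance by meson
  show ?thesis
  proof (intro exI[of _ "C / r"] conjI allI impI)
    fix f p assume f: "f holomorphic_on S" "inj_on f S" and p: "p \<in> S - ball a r"
    have "r * norm (deriv f a) \<le> C * norm (f a - f p)"
    proof (rule C(2))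
      show "f p \<notin> f ` ball a r" using inj_on_image_mem_iff[OF f(2), of p "ball a r"] p assms by auto
    qed (use f assms in \<open>auto intro: holomorphic_on_subset inj_on_subset\<close>)
    then show "norm (deriv f a) \<le> C / r * norm (f p - f a)"
      using assms by (simp add: field_simps norm_minus_commute)
  qed (use C assms in auto)
qed

section \<open>Sums over iterated preimages\<close>

text \<open>Integrals over counting measures come with monotonicity, constant factors, exchange of sums and
  disjoint unions for extended nonnegative values.\<close>
lemma infsum_ennreal_eq_nn_integral:
  fixes f :: "'a \<Rightarrow> ennreal"
  assumes A: "countable A"
  shows "(\<Sum>\<^sub>\<infinity>x\<in>A. f x) = (\<integral>\<^sup>+x. f x \<partial>count_space A)"
proof (cases "A = {}")
  case False
  have fin: "(\<integral>\<^sup>+x. f x * indicator F x \<partial>count_space A) = sum f F" if "finite F" "F \<subseteq> A" for F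
  proof -
    have "(\<integral>\<^sup>+x. f x * indicator F x \<partial>count_space A) = (\<integral>\<^sup>+x. f x \<partial>count_space F)"
      using that by (subst (1 2) nn_integral_count_space_indicator)
        (auto intro!: nn_integral_cong split: split_indicator)
    then show ?thesis using that by (simp add: nn_integral_count_space_finite)
  qed
  have sup: "(\<Sum>\<^sub>\<infinity>x\<in>A. f x) = (SUP F\<in>{F. finite F \<and> F \<subseteq> A}. sum f F)"
    by (rule nonneg_infsum_complete) auto
  show ?thesis
  proof (rule antisym)
    show "(\<Sum>\<^sub>\<infinity>x\<in>A. f x) \<le> (\<integral>\<^sup>+x. f x \<partial>count_space A)"
      unfolding sup
    proof (rule SUP_least)
      fix F assume "F \<in> {F. finite F \<and> F \<subseteq> A}"
      then have "sum f F = (\<integral>\<^sup>+x. f x * indicator F x \<partial>count_space A)" using fin by auto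
      also have "\<dots> \<le> (\<integral>\<^sup>+x. f x \<partial>count_space A)"
        by (intro nn_integral_mono) (auto split: split_indicator)
      finally show "sum f F \<le> (\<integral>\<^sup>+x. f x \<partial>count_space A)" .
    qed
    define F where "F n = A \<inter> from_nat_into A ` {..n}" for n
    have F: "finite (F n)" "F n \<subseteq> A" for n unfolding F_def by auto
    have mono: "F m \<subseteq> F n" if "m \<le> n" for m n using that unfolding F_def by auto
    have "f x = (SUP n. f x * indicator (F n) x)" if x: "x \<in> A" for x
    proof (rule antisym)
      obtain n where "x = from_nat_into A n" using from_nat_into_surj[OF A x] by metis
      then have "x \<in> F n" using x unfolding F_def by auto
      then show "f x \<le> (SUP n. f x * indicator (F n) x)" by (intro SUP_upper2[of n]) auto
      show "(SUP n. f x * indicator (F n) x) \<le> f x" by (rule SUP_least) (auto split: split_indicator)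
    qed
    then have "(\<integral>\<^sup>+x. f x \<partial>count_space A) = (\<integral>\<^sup>+x. (SUP n. f x * indicator (F n) x) \<partial>count_space A)"
      by (intro nn_integral_cong) auto
    also have "\<dots> = (SUP n. \<integral>\<^sup>+x. f x * indicator (F n) x \<partial>count_space A)"
      by (rule nn_integral_monotone_convergence_SUP)
        (use mono in \<open>auto simp: incseq_def le_fun_def split: split_indicator\<close>)
    also have "\<dots> \<le> (\<Sum>\<^sub>\<infinity>x\<in>A. f x)"
      unfolding sup fin[OF F] using F by (intro SUP_mono) auto
    finally show "(\<integral>\<^sup>+x. f x \<partial>count_space A) \<le> (\<Sum>\<^sub>\<infinity>x\<in>A. f x)" .
  qed
qed (simp add: nn_integral_empty)

lemma nn_integral_count_space_UN_disjoint:
  fixes f :: "'a \<Rightarrow> ennreal"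
  assumes J: "countable J" and disj: "disjoint_family_on A J"
  shows "(\<integral>\<^sup>+x. f x \<partial>count_space (\<Union>j\<in>J. A j)) = (\<integral>\<^sup>+j. \<integral>\<^sup>+x. f x \<partial>count_space (A j) \<partial>count_space J)"
proof -
  have ind: "(\<integral>\<^sup>+j. f x * indicator (A j) x \<partial>count_space J) = f x * indicator (\<Union>j\<in>J. A j) x" for x
  proof (cases "x \<in> (\<Union>j\<in>J. A j)")
    case True
    then obtain i where i: "i \<in> J" "x \<in> A i" by auto
    then have "(\<integral>\<^sup>+j. f x * indicator (A j) x \<partial>count_space J) = (\<integral>\<^sup>+j. f x * indicator {i} j \<partial>count_space J)"
      using disj by (intro nn_integral_cong) (auto simp: disjoint_family_on_def split: split_indicator)
    also have "\<dots> = f x" using i by (simp add: nn_integral_cmult_indicator)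
    finally show ?thesis using True by simp
  qed (auto simp: nn_integral_0_iff_AE AE_count_space)
  have "(\<integral>\<^sup>+x. f x \<partial>count_space (\<Union>j\<in>J. A j)) = (\<integral>\<^sup>+x. f x * indicator (\<Union>j\<in>J. A j) x \<partial>count_space UNIV)"
    by (cases "(\<Union>j\<in>J. A j) = UNIV") (simp_all add: nn_integral_count_space_indicator)
  also have "\<dots> = (\<integral>\<^sup>+x. \<integral>\<^sup>+j. f x * indicator (A j) x \<partial>count_space J \<partial>count_space UNIV)"
    by (simp add: ind)
  also have "\<dots> = (\<integral>\<^sup>+j. \<integral>\<^sup>+x. f x * indicator (A j) x \<partial>count_space UNIV \<partial>count_space J)"
    by (rule nn_integral_count_space_nn_integral[OF J]) auto
  also have "\<dots> = (\<integral>\<^sup>+j. \<integral>\<^sup>+x. f x \<partial>count_space (A j) \<partial>count_space J)"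
  proof (intro nn_integral_cong)
    fix j show "(\<integral>\<^sup>+x. f x * indicator (A j) x \<partial>count_space UNIV) = (\<integral>\<^sup>+x. f x \<partial>count_space (A j))"
      by (cases "A j = UNIV") (simp_all add: nn_integral_count_space_indicator)
  qed
  finally show ?thesis .
qed

text \<open>The \<open>n\<close>-th iterate of the transfer operator applied to the constant \<open>1\<close>, for the weights \<open>\<bar>\<psi>\<^sub>j'\<bar>\<^sup>t\<close>. It is
  defined through functions \<open>\<psi>\<close> rather than through the repeller, so that it makes sense wherever the extended
  branches do.\<close>
primrec partition_sum :: "nat set \<Rightarrow> (nat \<Rightarrow> complex \<Rightarrow> complex) \<Rightarrow> real \<Rightarrow> nat \<Rightarrow> complex \<Rightarrow> ennreal" where
  "partition_sum J \<psi> t 0 x = 1"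
| "partition_sum J \<psi> t (Suc n) x =
     (\<integral>\<^sup>+j. ennreal (norm (deriv (\<psi> j) x) powr t) * partition_sum J \<psi> t n (\<psi> j x) \<partial>count_space J)"

lemma repeller_inverse_branch:
  assumes rep: "generalised_Cantor_repeller J Dj D \<phi>" and j: "j \<in> J"
    and \<psi>: "\<And>w. w \<in> D \<Longrightarrow> \<psi> w = inv_into (Dj j) \<phi> w"
    and x: "x \<in> D"
  shows "\<psi> x \<in> Dj j" "\<psi> x \<in> D" "\<phi> (\<psi> x) = x" "\<And>z. z \<in> Dj j \<Longrightarrow> \<phi> z = x \<Longrightarrow> z = \<psi> x"
    "deriv \<phi> (\<psi> x) * deriv \<psi> x = 1"
proof -
  have D: "open D" and Dj: "open (Dj j)" "Dj j \<subseteq> D"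
    and hol: "\<phi> holomorphic_on Dj j" "bij_betw \<phi> (Dj j) D" "inv_into (Dj j) \<phi> holomorphic_on D"
    using rep j closure_subset[of "Dj j"]
    unfolding generalised_Cantor_repeller_def topological_disc_def biholomorphic_onto_def compactly_contained_def by auto
  have in_Dj: "\<psi> w \<in> Dj j" and right: "\<phi> (\<psi> w) = w" if "w \<in> D" for w
    using hol(2) that \<psi>[OF that] by (auto simp: bij_betw_def inv_into_into f_inv_into_f)
  show "\<psi> x \<in> Dj j" "\<psi> x \<in> D" "\<phi> (\<psi> x) = x" using in_Dj right x Dj by auto
  show "z = \<psi> x" if "z \<in> Dj j" "\<phi> z = x" for z
    using that hol(2) \<psi>[OF x] by (auto simp: bij_betw_def)
  have "\<psi> holomorphic_on D" by (rule holomorphic_transform[OF hol(3)]) (simp add: \<psi>)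
  then have d\<psi>: "(\<psi> has_field_derivative deriv \<psi> x) (at x)"
    using D x by (simp add: holomorphic_derivI)
  have "(\<phi> has_field_derivative deriv \<phi> (\<psi> x)) (at (\<psi> x))"
    using hol(1) Dj in_Dj[OF x] by (simp add: holomorphic_derivI)
  from DERIV_chain2[OF this d\<psi>]
  have "((\<lambda>w. \<phi> (\<psi> w)) has_field_derivative deriv \<phi> (\<psi> x) * deriv \<psi> x) (at x)" .
  moreover have "((\<lambda>w. \<phi> (\<psi> w)) has_field_derivative 1) (at x)"
    by (rule has_field_derivative_transform_within_open[OF DERIV_ident D x]) (simp add: right)
  ultimately show "deriv \<phi> (\<psi> x) * deriv \<psi> x = 1" by (rule DERIV_unique)
qed

text \<open>The preimages of \<open>x\<close> under the iterate of order \<open>n + 1\<close> are those of the points \<open>\<psi>\<^sub>j x\<close> under the iterate of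
  order \<open>n\<close>, disjointly over \<open>j\<close>, and the chain rule splits off the factor \<open>\<phi>'(\<psi>\<^sub>j x) = 1 / \<psi>\<^sub>j'(x)\<close>. This is
  the recursion of \<open>partition_sum\<close>.\<close>
lemma infsum_iterate_preimage:
  assumes rep: "generalised_Cantor_repeller J Dj D \<phi>"
    and \<psi>: "\<And>j w. j \<in> J \<Longrightarrow> w \<in> D \<Longrightarrow> \<psi> j w = inv_into (Dj j) \<phi> w"
    and x: "x \<in> D"
  shows "(\<Sum>\<^sub>\<infinity>z\<in>iterate_preimage (\<Union>j\<in>J. Dj j) \<phi> n x. ennreal (norm (deriv (\<phi> ^^ n) z) powr (- t)))
    = partition_sum J \<psi> t n x"
proof -
  define U where "U = (\<Union>j\<in>J. Dj j)"
  have inv: "\<psi> j x \<in> Dj j" "\<psi> j x \<in> D" "\<phi> (\<psi> j x) = x" "deriv \<phi> (\<psi> j x) * deriv (\<psi> j) x = 1"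
    and inv_unique: "\<And>z. z \<in> Dj j \<Longrightarrow> \<phi> z = x \<Longrightarrow> z = \<psi> j x" if "j \<in> J" "x \<in> D" for j x
    using repeller_inverse_branch[OF rep that(1) \<psi>[OF that(1)] that(2)] by blast+
  have disj: "Dj i \<inter> Dj j = {}" if "i \<in> J" "j \<in> J" "i \<noteq> j" for i j
  proof -
    have "closure (Dj i) \<inter> closure (Dj j) = {}"
      using rep that unfolding generalised_Cantor_repeller_def by blast
    then show ?thesis using closure_subset[of "Dj i"] closure_subset[of "Dj j"] by auto
  qed
  have openU: "open U"
    using rep unfolding U_def generalised_Cantor_repeller_def topological_disc_def by blast
  have hol: "\<phi> field_differentiable at z" if z: "z \<in> U" for z
  proof -
    obtain j where j: "j \<in> J" "z \<in> Dj j" using z unfolding U_def by auto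
    then have "\<phi> holomorphic_on Dj j" "open (Dj j)"
      using rep unfolding generalised_Cantor_repeller_def biholomorphic_onto_def topological_disc_def by auto
    then show ?thesis using j by (auto intro: holomorphic_on_imp_differentiable_at)
  qed
  have iter_hol: "(\<phi> ^^ n) field_differentiable at z" if "\<forall>k<n. (\<phi> ^^ k) z \<in> U" for n z
    using that
  proof (induction n)
    case (Suc n)
    then have "(\<phi> ^^ n) field_differentiable at z" "\<phi> field_differentiable at ((\<phi> ^^ n) z)"
      by (auto intro: hol)
    from field_differentiable_compose[OF this] show ?case by (simp add: o_def)
  qed (auto simp: id_def)
  have step: "iterate_preimage U \<phi> (Suc n) x = (\<Union>j\<in>J. iterate_preimage U \<phi> n (\<psi> j x))" if x: "x \<in> D" for n x
  proof (intro equalityI subsetI)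
    fix z assume z: "z \<in> iterate_preimage U \<phi> (Suc n) x"
    then have "(\<phi> ^^ n) z \<in> U" "\<phi> ((\<phi> ^^ n) z) = x" unfolding iterate_preimage_def by auto
    then obtain j where "j \<in> J" "(\<phi> ^^ n) z = \<psi> j x" using inv_unique[OF _ x] unfolding U_def by blast
    then show "z \<in> (\<Union>j\<in>J. iterate_preimage U \<phi> n (\<psi> j x))"
      using z unfolding iterate_preimage_def by auto
  next
    fix z assume "z \<in> (\<Union>j\<in>J. iterate_preimage U \<phi> n (\<psi> j x))"
    then obtain j where j: "j \<in> J" "z \<in> iterate_preimage U \<phi> n (\<psi> j x)" by auto
    then show "z \<in> iterate_preimage U \<phi> (Suc n) x"
      using inv(1,3)[OF j(1) x] unfolding iterate_preimage_def U_def
      by (auto simp: less_Suc_eq)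
  qed
  have disj': "disjoint_family_on (\<lambda>j. iterate_preimage U \<phi> n (\<psi> j x)) J" if x: "x \<in> D" for n x
    unfolding disjoint_family_on_def iterate_preimage_def
    using disj inv(1)[OF _ x] by fastforce
  have cnt: "countable (iterate_preimage U \<phi> n x)" if "x \<in> D" for n x
    using that
  proof (induction n arbitrary: x)
    case (Suc n)
    then show ?case using inv(2)[OF _ Suc.prems] by (auto simp: step)
  qed (auto simp: iterate_preimage_def)
  have "(\<integral>\<^sup>+z. ennreal (norm (deriv (\<phi> ^^ n) z) powr (- t)) \<partial>count_space (iterate_preimage U \<phi> n x))
     = partition_sum J \<psi> t n x"
    using x
  proof (induction n arbitrary: x)
    case 0
    have "iterate_preimage U \<phi> 0 x = {x}" unfolding iterate_preimage_def by auto
    then show ?case by (simp add: nn_integral_count_space_finite id_def)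
  next
    case (Suc n)
    have "(\<integral>\<^sup>+z. ennreal (norm (deriv (\<phi> ^^ Suc n) z) powr (- t)) \<partial>count_space (iterate_preimage U \<phi> (Suc n) x))
      = (\<integral>\<^sup>+j. \<integral>\<^sup>+z. ennreal (norm (deriv (\<phi> ^^ Suc n) z) powr (- t)) \<partial>count_space (iterate_preimage U \<phi> n (\<psi> j x))
           \<partial>count_space J)"
      unfolding step[OF Suc.prems] by (rule nn_integral_count_space_UN_disjoint[OF _ disj'[OF Suc.prems]]) simp
    also have "\<dots> = partition_sum J \<psi> t (Suc n) x"
      unfolding partition_sum.simps
    proof (intro nn_integral_cong)
      fix j assume "j \<in> space (count_space J)"
      then have j: "j \<in> J" by simp
      have xj: "\<psi> j x \<in> D" "\<psi> j x \<in> U" using inv(1,2)[OF j Suc.prems] j unfolding U_def by auto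
      have "norm (deriv (\<phi> ^^ Suc n) z) powr (- t)
          = norm (deriv (\<psi> j) x) powr t * norm (deriv (\<phi> ^^ n) z) powr (- t)"
        if z: "z \<in> iterate_preimage U \<phi> n (\<psi> j x)" for z
      proof -
        have *: "(\<phi> ^^ n) z = \<psi> j x" "(\<phi> ^^ n) field_differentiable at z"
          using z iter_hol unfolding iterate_preimage_def by auto
        have "deriv (\<phi> \<circ> (\<phi> ^^ n)) z = deriv \<phi> (\<psi> j x) * deriv (\<phi> ^^ n) z"
          using deriv_chain[of "\<phi> ^^ n" z \<phi>] * hol[OF xj(2)] by simp
        moreover have "norm (deriv \<phi> (\<psi> j x)) * norm (deriv (\<psi> j) x) = 1"
          using inv(4)[OF j Suc.prems] by (simp flip: norm_mult)
        then have "norm (deriv \<phi> (\<psi> j x)) = inverse (norm (deriv (\<psi> j) x))"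
          by (metis inverse_unique mult.commute)
        ultimately show ?thesis
          by (simp add: norm_mult powr_mult powr_minus inverse_powr)
      qed
      then have "(\<integral>\<^sup>+z. ennreal (norm (deriv (\<phi> ^^ Suc n) z) powr (- t)) \<partial>count_space (iterate_preimage U \<phi> n (\<psi> j x)))
        = (\<integral>\<^sup>+z. ennreal (norm (deriv (\<psi> j) x) powr t) * ennreal (norm (deriv (\<phi> ^^ n) z) powr (- t))
            \<partial>count_space (iterate_preimage U \<phi> n (\<psi> j x)))"
        by (intro nn_integral_cong) (simp add: ennreal_mult del: funpow.simps)
      also have "\<dots> = ennreal (norm (deriv (\<psi> j) x) powr t) * partition_sum J \<psi> t n (\<psi> j x)"
        using Suc.IH[OF xj(1)] by (simp add: nn_integral_cmult)
      finally show "(\<integral>\<^sup>+z. ennreal (norm (deriv (\<phi> ^^ Suc n) z) powr (- t)) \<partial>count_space (iterate_preimage U \<phi> n (\<psi> j x)))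
        = ennreal (norm (deriv (\<psi> j) x) powr t) * partition_sum J \<psi> t n (\<psi> j x)" .
    qed
    finally show ?case .
  qed
  then show ?thesis using infsum_ennreal_eq_nn_integral[OF cnt[OF x]] unfolding U_def by simp
qed

section \<open>Bounded distortion and existence of the pressure\<close>

text \<open>Instead of listing compositions of branches, the induction carries an arbitrary univalent \<open>g\<close> along: the
  transfer operator replaces \<open>g\<close> by the functions \<open>\<psi>\<^sub>j \<circ> g\<close>, which are again univalent self-maps of \<open>S\<close>, so
  that \<open>M\<close> enters only once, at the end of the recursion. For \<open>g = id\<close> it compares the partition sums at two
  points with a constant independent of \<open>n\<close>.\<close>
lemma partition_sum_distortion:
  assumes S: "open S"
    and M: "\<And>f x y. \<lbrakk>f holomorphic_on S; inj_on f S; x \<in> K; y \<in> K\<rbrakk> \<Longrightarrow> norm (deriv f x) \<le> M * norm (deriv f y)"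
    and K: "K \<subseteq> S" and M0: "M \<ge> 0"
    and \<psi>: "\<And>j. j \<in> J \<Longrightarrow> \<psi> j holomorphic_on S" "\<And>j. j \<in> J \<Longrightarrow> inj_on (\<psi> j) S" "\<And>j. j \<in> J \<Longrightarrow> \<psi> j ` S \<subseteq> S"
    and t: "t \<ge> 0" and xy: "x \<in> K" "y \<in> K"
    and g: "g holomorphic_on S" "inj_on g S" "g ` S \<subseteq> S"
  shows "ennreal (norm (deriv g x) powr t) * partition_sum J \<psi> t n (g x)
    \<le> ennreal (M powr t) * (ennreal (norm (deriv g y) powr t) * partition_sum J \<psi> t n (g y))"
  using g
proof (induction n arbitrary: g)
  case 0
  have "norm (deriv g x) powr t \<le> (M * norm (deriv g y)) powr t"
    using M[OF 0(1,2) xy] t by (intro powr_mono2) auto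
  also have "\<dots> = M powr t * norm (deriv g y) powr t"
    using M0 by (simp add: powr_mult)
  finally show ?case by (simp flip: ennreal_mult)
next
  case (Suc n)
  have expand: "ennreal (norm (deriv g z) powr t) * partition_sum J \<psi> t (Suc n) (g z)
     = (\<integral>\<^sup>+j. ennreal (norm (deriv (\<psi> j \<circ> g) z) powr t) * partition_sum J \<psi> t n ((\<psi> j \<circ> g) z) \<partial>count_space J)"
    if z: "z \<in> K" for z
  proof -
    have zS: "z \<in> S" "g z \<in> S" using z K Suc.prems(3) by auto
    have "deriv (\<psi> j \<circ> g) z = deriv (\<psi> j) (g z) * deriv g z" if j: "j \<in> J" for j
      by (rule deriv_chain) (use zS S Suc.prems(1) \<psi>(1)[OF j] in \<open>auto intro: holomorphic_on_imp_differentiable_at\<close>)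
    then have "ennreal (norm (deriv (\<psi> j \<circ> g) z) powr t)
        = ennreal (norm (deriv g z) powr t) * ennreal (norm (deriv (\<psi> j) (g z)) powr t)" if j: "j \<in> J" for j
      using j by (simp add: norm_mult powr_mult mult.commute flip: ennreal_mult)
    then show ?thesis
      unfolding partition_sum.simps
      by (subst nn_integral_cmult[symmetric]) (auto intro!: nn_integral_cong simp: mult.assoc)
  qed
  have "ennreal (norm (deriv g x) powr t) * partition_sum J \<psi> t (Suc n) (g x)
      \<le> (\<integral>\<^sup>+j. ennreal (M powr t) * (ennreal (norm (deriv (\<psi> j \<circ> g) y) powr t) * partition_sum J \<psi> t n ((\<psi> j \<circ> g) y)) \<partial>count_space J)"
    unfolding expand[OF xy(1)]
  proof (intro nn_integral_mono)
    fix j assume "j \<in> space (count_space J)"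
    then have j: "j \<in> J" by simp
    show "ennreal (norm (deriv (\<psi> j \<circ> g) x) powr t) * partition_sum J \<psi> t n ((\<psi> j \<circ> g) x)
      \<le> ennreal (M powr t) * (ennreal (norm (deriv (\<psi> j \<circ> g) y) powr t) * partition_sum J \<psi> t n ((\<psi> j \<circ> g) y))"
    proof (rule Suc.IH)
      show "\<psi> j \<circ> g holomorphic_on S"
        by (rule holomorphic_on_compose_gen[OF Suc.prems(1) \<psi>(1)[OF j]]) (use Suc.prems(3) in auto)
      show "inj_on (\<psi> j \<circ> g) S"
        using Suc.prems \<psi>(2)[OF j] by (auto intro: comp_inj_on inj_on_subset)
      show "(\<psi> j \<circ> g) ` S \<subseteq> S" using Suc.prems(3) \<psi>(3)[OF j] by auto
    qed
  qed
  also have "\<dots> = ennreal (M powr t) * (ennreal (norm (deriv g y) powr t) * partition_sum J \<psi> t (Suc n) (g y))"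
    unfolding expand[OF xy(2)] by (rule nn_integral_cmult) auto
  finally show ?case .
qed

text \<open>The \<open>n\<close>-th iterate of the operator is positive and linear, so it preserves upper and lower
  bounds of the \<open>m\<close>-th partition sum by constants.\<close>
lemma partition_sum_add_le:
  assumes inv: "\<And>j x. j \<in> J \<Longrightarrow> x \<in> A \<Longrightarrow> \<psi> j x \<in> A" and c: "\<And>x. x \<in> A \<Longrightarrow> partition_sum J \<psi> t m x \<le> c"
    and x: "x \<in> A"
  shows "partition_sum J \<psi> t (n + m) x \<le> c * partition_sum J \<psi> t n x"
  using x
proof (induction n arbitrary: x)
  case (Suc n)
  have "partition_sum J \<psi> t (Suc n + m) x
     \<le> (\<integral>\<^sup>+j. c * (ennreal (norm (deriv (\<psi> j) x) powr t) * partition_sum J \<psi> t n (\<psi> j x)) \<partial>count_space J)"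
    unfolding add_Suc partition_sum.simps
    using Suc.IH[OF inv[OF _ Suc.prems]]
    by (intro nn_integral_mono) (auto simp: mult.left_commute[of c] intro!: mult_left_mono)
  also have "\<dots> = c * partition_sum J \<psi> t (Suc n) x" by (simp add: nn_integral_cmult)
  finally show ?case .
qed (use c in auto)

lemma partition_sum_add_ge:
  assumes inv: "\<And>j x. j \<in> J \<Longrightarrow> x \<in> A \<Longrightarrow> \<psi> j x \<in> A" and c: "\<And>x. x \<in> A \<Longrightarrow> c \<le> partition_sum J \<psi> t m x"
    and x: "x \<in> A"
  shows "c * partition_sum J \<psi> t n x \<le> partition_sum J \<psi> t (n + m) x"
  using x
proof (induction n arbitrary: x)
  case (Suc n)
  have "c * partition_sum J \<psi> t (Suc n) x =
     (\<integral>\<^sup>+j. c * (ennreal (norm (deriv (\<psi> j) x) powr t) * partition_sum J \<psi> t n (\<psi> j x)) \<partial>count_space J)"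
    by (simp add: nn_integral_cmult)
  also have "\<dots> \<le> partition_sum J \<psi> t (Suc n + m) x"
    unfolding add_Suc partition_sum.simps
    using Suc.IH[OF inv[OF _ Suc.prems]]
    by (intro nn_integral_mono) (auto simp: mult.left_commute[of c] intro!: mult_left_mono)
  finally show ?case .
qed (use c in auto)

text \<open>Comparing \<open>a (k * n)\<close> with \<open>k * a n\<close> and with \<open>n * a k\<close> shows that any two terms of \<open>a n / n\<close> differ by at
  most \<open>c / k + c / n\<close>. Compared with Fekete's lemma, two-sided control yields a rate of convergence.\<close>
lemma quasi_additive_limit:
  fixes a :: "nat \<Rightarrow> real"
  assumes a: "\<And>m n. \<bar>a (m + n) - a m - a n\<bar> \<le> c"
  shows "\<exists>L. (\<lambda>n. a n / n) \<longlonglongrightarrow> L \<and> (\<forall>n>0. \<bar>a n / n - L\<bar> \<le> c / n)"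
proof -
  have c0: "c \<ge> 0" using a[of 0 0] by linarith
  have mult: "\<bar>a (Suc k * n) - Suc k * a n\<bar> \<le> k * c" for k n
  proof (induction k)
    case (Suc k)
    have "\<bar>a (n + Suc k * n) - a n - a (Suc k * n)\<bar> \<le> c" by (rule a)
    then show ?case using Suc by (simp add: algebra_simps)
  qed auto
  have div: "\<bar>a (k * n) / (k * n) - a n / n\<bar> \<le> c / n" if k: "k > 0" and n: "n > 0" for k n :: nat
  proof -
    have "\<bar>a (k * n) - k * a n\<bar> \<le> (k - 1) * c" using mult[of "k - 1" n] k by simp
    also have "\<dots> \<le> k * c" using c0 by (intro mult_right_mono) auto
    finally have "\<bar>a (k * n) - k * a n\<bar> / (k * n) \<le> k * c / (k * n)" by (intro divide_right_mono) auto
    moreover have "a (k * n) / (k * n) - a n / n = (a (k * n) - k * a n) / (k * n)"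
      using k n by (simp add: diff_divide_distrib)
    ultimately show ?thesis using k by (simp only: abs_divide) simp
  qed
  have close: "\<bar>a m / m - a n / n\<bar> \<le> c / m + c / n" if "m > 0" "n > 0" for m n :: nat
    using div[OF that] div[OF that(2,1)] by (simp add: mult.commute)
  have c1: "(\<lambda>n. c / real n) \<longlonglongrightarrow> 0" by (rule lim_const_over_n)
  have "Cauchy (\<lambda>n. a n / n)"
  proof (rule metric_CauchyI)
    fix e :: real assume e: "e > 0"
    have "\<forall>\<^sub>F n in sequentially. c / real n < e / 2 \<and> n > 0"
      using order_tendstoD(2)[OF c1, of "e/2"] e eventually_gt_at_top[of 0] by (auto intro: eventually_conj)
    then obtain N where N: "\<And>n. n \<ge> N \<Longrightarrow> c / real n < e/2 \<and> n > 0" by (auto simp: eventually_sequentially)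
    show "\<exists>M. \<forall>m\<ge>M. \<forall>n\<ge>M. dist (a m / m) (a n / n) < e"
    proof (intro exI[of _ N] allI impI)
      fix m n assume "m \<ge> N" "n \<ge> N"
      then have "c / m < e / 2" "c / n < e / 2" "m > 0" "n > 0" using N by blast+
      then show "dist (a m / m) (a n / n) < e"
        using close[of m n] unfolding dist_real_def by linarith
    qed
  qed
  then obtain L where L: "(\<lambda>n. a n / n) \<longlonglongrightarrow> L" by (auto simp: Cauchy_convergent_iff convergent_def)
  have "\<bar>a n / n - L\<bar> \<le> c / n" if n: "n > 0" for n :: nat
  proof (rule tendsto_upperbound)
    show "(\<lambda>m. \<bar>a n / n - a m / m\<bar> - c / m) \<longlonglongrightarrow> \<bar>a n / n - L\<bar>"
      using tendsto_diff[OF tendsto_rabs[OF tendsto_diff[OF tendsto_const L]] c1] by simp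
    show "\<forall>\<^sub>F m in sequentially. \<bar>a n / n - a m / m\<bar> - c / m \<le> c / n"
      using eventually_gt_at_top[of 0] by eventually_elim (use close[OF n] in \<open>auto simp: algebra_simps\<close>)
  qed auto
  with L show ?thesis by auto
qed

text \<open>The distortion bound makes the logarithms of the partition sums at \<open>0\<close> additive up to \<open>t * ln M\<close>. The rate in
  the conclusion depends on the system only through \<open>M\<close>; this is what permits passing to a limit in families.\<close>
lemma pressure_seq_tendsto:
  assumes rep: "generalised_Cantor_repeller J Dj D \<phi>" and D0: "0 \<in> D"
    and S: "open S" and D: "D \<subseteq> S"
    and M: "\<And>f x y. \<lbrakk>f holomorphic_on S; inj_on f S; x \<in> D; y \<in> D\<rbrakk> \<Longrightarrow> norm (deriv f x) \<le> M * norm (deriv f y)"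
    and M1: "M \<ge> 1"
    and \<psi>: "\<And>j. j \<in> J \<Longrightarrow> \<psi> j holomorphic_on S" "\<And>j. j \<in> J \<Longrightarrow> inj_on (\<psi> j) S" "\<And>j. j \<in> J \<Longrightarrow> \<psi> j ` S \<subseteq> S"
    and inverse: "\<And>j w. j \<in> J \<Longrightarrow> w \<in> D \<Longrightarrow> \<psi> j w = inv_into (Dj j) \<phi> w"
    and t: "t \<ge> 0"
    and fin: "\<And>n. 0 < partition_sum J \<psi> t n 0" "\<And>n. partition_sum J \<psi> t n 0 < \<infinity>"
  shows "\<exists>P. pressure_seq (\<Union>j\<in>J. Dj j) \<phi> t \<longlonglongrightarrow> ereal P \<and>
    (\<forall>n>0. \<bar>ln (enn2real (partition_sum J \<psi> t n 0)) / n - P\<bar> \<le> t * ln M / n)"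
proof -
  define Z where "Z n = enn2real (partition_sum J \<psi> t n 0)" for n
  have Z: "partition_sum J \<psi> t n 0 = ennreal (Z n)" "Z n > 0" for n
    using fin[of n] unfolding Z_def by (auto simp: enn2real_positive_iff)
  have Mt: "M powr t > 0" using M1 by simp
  have inv: "\<psi> j x \<in> D" if "j \<in> J" "x \<in> D" for j x
    using repeller_inverse_branch(2)[OF rep that(1) inverse[OF that(1)] that(2)] by simp
  have dis: "partition_sum J \<psi> t n x \<le> ennreal (M powr t) * partition_sum J \<psi> t n y" if "x \<in> D" "y \<in> D" for x y n
    using partition_sum_distortion[where g = "\<lambda>x. x" and K = D and M = M and S = S and J = J and \<psi> = \<psi> and t = t
        and n = n and x = x and y = y] S M D \<psi> t M1 that by simp
  have upper: "Z (n + m) \<le> M powr t * Z m * Z n" for n m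
  proof -
    have "partition_sum J \<psi> t (n + m) 0 \<le> ennreal (M powr t * Z m) * partition_sum J \<psi> t n 0"
      by (rule partition_sum_add_le[where A = D]) (use inv dis[OF _ D0] D0 Z in \<open>auto simp: ennreal_mult less_imp_le\<close>)
    then show ?thesis using Z(2)[of n] Z(2)[of m] Mt by (simp add: Z(1) flip: ennreal_mult)
  qed
  have lower: "Z n * Z m \<le> M powr t * Z (n + m)" for n m
  proof -
    have "ennreal (Z m / M powr t) \<le> partition_sum J \<psi> t m x" if x: "x \<in> D" for x
    proof -
      have "ennreal (1 / M powr t) * ennreal (Z m) \<le> ennreal (1 / M powr t) * (ennreal (M powr t) * partition_sum J \<psi> t m x)"
        using dis[OF D0 x, of m] unfolding Z by (intro mult_left_mono) auto
      also have "\<dots> = ennreal (1 / M powr t * M powr t) * partition_sum J \<psi> t m x"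
        by (subst ennreal_mult) (auto simp: mult.assoc)
      also have "\<dots> = partition_sum J \<psi> t m x" using Mt by simp
      finally show ?thesis using Z(2)[of m] by (simp flip: ennreal_mult add: less_imp_le)
    qed
    then have "ennreal (Z m / M powr t) * partition_sum J \<psi> t n 0 \<le> partition_sum J \<psi> t (n + m) 0"
      by (intro partition_sum_add_ge[where A = D]) (use inv D0 in auto)
    then have "Z m / M powr t * Z n \<le> Z (n + m)"
      using Z(2)[of n] Z(2)[of m] Z(2)[of "n+m"] Mt by (simp add: Z(1) less_imp_le flip: ennreal_mult)
    then show ?thesis using Mt by (simp add: field_simps)
  qed
  have "\<bar>ln (Z (m + n)) - ln (Z m) - ln (Z n)\<bar> \<le> t * ln M" for m n
  proof -
    have "ln (Z (m + n)) \<le> ln (M powr t * Z n * Z m)" using upper[of m n] Z(2) Mt by simp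
    moreover have "ln (Z m * Z n) \<le> ln (M powr t * Z (m + n))" using lower[of m n] Z(2) Mt by simp
    moreover have "ln (M powr t * Z n * Z m) = t * ln M + ln (Z n) + ln (Z m)" "ln (Z m * Z n) = ln (Z m) + ln (Z n)"
      "ln (M powr t * Z (m + n)) = t * ln M + ln (Z (m + n))"
      using Z(2)[of m] Z(2)[of n] Z(2)[of "m+n"] Mt M1 by (simp_all add: ln_mult_pos ln_powr)
    ultimately show ?thesis by linarith
  qed
  from quasi_additive_limit[OF this] obtain P where
    P: "(\<lambda>n. ln (Z n) / n) \<longlonglongrightarrow> P" "\<And>n. n > 0 \<Longrightarrow> \<bar>ln (Z n) / n - P\<bar> \<le> t * ln M / n" by auto
  have "pressure_seq (\<Union>j\<in>J. Dj j) \<phi> t n = ereal (ln (Z n) / n)" for n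
    using infsum_iterate_preimage[where \<psi> = \<psi> and n = n and t = t, OF rep inverse D0] Z[of n]
    unfolding pressure_seq_def by (simp add: ext_ln_def infinity_ennreal_def)
  then have "pressure_seq (\<Union>j\<in>J. Dj j) \<phi> t = (\<lambda>n. ereal (ln (Z n) / n))" by auto
  with P show ?thesis by (auto simp: Z_def)
qed

section \<open>Uniform tails and limits of sums\<close>

text \<open>In the slice \<open>exp (- s - k - 1) \<le> a j < exp (- s - k)\<close> the factor \<open>a j powr (t - 1)\<close> is at most a constant times
  \<open>exp ((s + k + 1) * \<kappa> / 2)\<close>, which spends only half of the decay \<open>exp (- (s + k) * \<kappa>)\<close> of the tails; the remaining
  half is summed as a geometric series in \<open>k\<close>. For \<open>t > 1\<close> the factor may be large when \<open>a j > 1\<close>, whence the bound \<open>L\<close>.\<close>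
lemma nn_integral_power_tail:
  fixes a :: "'i \<Rightarrow> real"
  assumes a: "\<And>j. j \<in> J \<Longrightarrow> 0 \<le> a j" "\<And>j. j \<in> J \<Longrightarrow> a j \<le> L" and L: "L \<ge> 1"
    and \<kappa>: "\<kappa> > 0" and C: "C \<ge> 0"
    and tails: "\<And>s. (\<integral>\<^sup>+j. ennreal (a j) \<partial>count_space {j\<in>J. a j < exp (- s)}) \<le> ennreal (C * exp (- s * \<kappa>))"
    and t: "\<bar>t - 1\<bar> \<le> \<kappa> / 2"
  shows "(\<integral>\<^sup>+j. ennreal (a j powr t) \<partial>count_space {j\<in>J. a j < exp (- s)})
    \<le> ennreal (L powr \<kappa> * C * exp (\<kappa> / 2) / (1 - exp (- \<kappa> / 2)) * exp (- s * \<kappa> / 2))"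
proof -
  define A where "A s = {j\<in>J. a j < exp (- s)}" for s
  define c where "c k = L powr \<kappa> * exp ((s + real k + 1) * \<kappa> / 2)" for k :: nat
  define b where "b = L powr \<kappa> * C * exp (\<kappa> / 2) * exp (- s * \<kappa> / 2)"
  define q where "q = exp (- \<kappa> / 2)"
  have q: "0 \<le> q" "q < 1" unfolding q_def using \<kappa> by auto
  have b: "b \<ge> 0" unfolding b_def using C by simp
  \<comment> \<open>Bounding by the sum over all slices avoids partitioning the index set.\<close>
  have pointwise: "ennreal (a j powr t) \<le> (\<Sum>k. ennreal (c k) * (ennreal (a j) * indicator (A (s + real k)) j))"
    if j: "j \<in> A s" for j
  proof (cases "a j = 0")
    case False
    then have aj: "a j > 0" "a j \<le> L" "a j < exp (- s)" "j \<in> J" using a[of j] j unfolding A_def by auto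
    define y where "y = - ln (a j) - s"
    have "ln (a j) < - s" using aj by (metis exp_gt_zero exp_less_cancel_iff exp_ln)
    then have y: "y > 0" unfolding y_def by simp
    define k where "k = nat (\<lceil>y\<rceil> - 1)"
    have k: "real k < y" "y \<le> real k + 1"
      using y unfolding k_def by (simp_all add: of_nat_nat) linarith+
    have "ln (a j) < - (s + k)" "ln (a j) \<ge> - (s + k + 1)" using k unfolding y_def by auto
    then have lt: "a j < exp (- (s + k))" and ge: "exp (- (s + k + 1)) \<le> a j"
      using aj(1) by (metis exp_less_cancel_iff exp_ln, metis exp_le_cancel_iff exp_ln)
    have "a j powr (- \<kappa> / 2) \<le> exp (- (s + k + 1)) powr (- \<kappa> / 2)"
      using ge \<kappa> aj(1) by (intro powr_mono2') auto
    also have "\<dots> = exp ((s + k + 1) * \<kappa> / 2)" by (simp add: exp_powr_real) (simp add: field_simps)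
    finally have 1: "a j powr (- \<kappa> / 2) \<le> exp ((s + k + 1) * \<kappa> / 2)" .
    have q_bounds: "0 \<le> t - 1 + \<kappa> / 2" "t - 1 + \<kappa> / 2 \<le> \<kappa>" using t by linarith+
    have "a j powr (t - 1 + \<kappa> / 2) \<le> L powr (t - 1 + \<kappa> / 2)"
      using aj q_bounds(1) by (intro powr_mono2) auto
    also have "\<dots> \<le> L powr \<kappa>" using L q_bounds(2) by (intro powr_mono) auto
    finally have 2: "a j powr (t - 1 + \<kappa> / 2) \<le> L powr \<kappa>" .
    have "a j powr t = a j powr (- \<kappa> / 2) * a j powr (t - 1 + \<kappa> / 2) * a j powr 1"
      by (simp only: powr_add[symmetric]) simp
    also have "\<dots> \<le> c k * a j"
      using mult_mono[OF 1 2] aj unfolding c_def by (auto intro!: mult_right_mono simp: mult.commute)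
    finally have "ennreal (a j powr t) \<le> ennreal (c k) * (ennreal (a j) * indicator (A (s + real k)) j)"
      using lt aj unfolding A_def c_def by (simp flip: ennreal_mult)
    also have "\<dots> \<le> (\<Sum>k. ennreal (c k) * (ennreal (a j) * indicator (A (s + real k)) j))"
      using sum_le_suminf[OF summableI, of "{k}" "\<lambda>k. ennreal (c k) * (ennreal (a j) * indicator (A (s + real k)) j)"] by simp
    finally show ?thesis .
  qed simp
  have "(\<integral>\<^sup>+j. ennreal (a j powr t) \<partial>count_space (A s))
     \<le> (\<integral>\<^sup>+j. (\<Sum>k. ennreal (c k) * (ennreal (a j) * indicator (A (s + real k)) j)) \<partial>count_space (A s))"
    by (intro nn_integral_mono) (use pointwise in simp)
  also have "\<dots> = (\<Sum>k. \<integral>\<^sup>+j. ennreal (c k) * (ennreal (a j) * indicator (A (s + real k)) j) \<partial>count_space (A s))"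
    by (rule nn_integral_suminf) simp
  also have "\<dots> = (\<Sum>k. ennreal (c k) * (\<integral>\<^sup>+j. ennreal (a j) * indicator (A (s + real k)) j \<partial>count_space (A s)))"
    by (simp add: nn_integral_cmult)
  also have "\<dots> \<le> (\<Sum>k. ennreal (b * q ^ k))"
  proof (intro suminf_le summableI allI)
    fix k
    have "A (s + real k) \<subseteq> A s"
      unfolding A_def by (auto intro: less_le_trans)
    then have "(\<integral>\<^sup>+j. ennreal (a j) * indicator (A (s + real k)) j \<partial>count_space (A s))
       = (\<integral>\<^sup>+j. ennreal (a j) * indicator (A (s + real k)) j \<partial>count_space (A (s + real k)))"
      by (intro nn_integral_count_space_eq) auto
    also have "\<dots> = (\<integral>\<^sup>+j. ennreal (a j) \<partial>count_space (A (s + real k)))"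
      by (intro nn_integral_cong) auto
    also have "\<dots> \<le> ennreal (C * exp (- (s + real k) * \<kappa>))" unfolding A_def by (rule tails)
    finally have "ennreal (c k) * (\<integral>\<^sup>+j. ennreal (a j) * indicator (A (s + real k)) j \<partial>count_space (A s))
       \<le> ennreal (c k) * ennreal (C * exp (- (s + real k) * \<kappa>))" by (rule mult_left_mono) simp
    also have "\<dots> = ennreal (c k * (C * exp (- (s + real k) * \<kappa>)))"
      using C unfolding c_def by (simp add: ennreal_mult)
    also have "c k * (C * exp (- (s + real k) * \<kappa>)) = b * q ^ k"
    proof -
      have "exp ((s + real k + 1) * \<kappa> / 2) * exp (- (s + real k) * \<kappa>) = exp (\<kappa> / 2) * exp (- s * \<kappa> / 2) * q ^ k"
        unfolding q_def by (simp flip: exp_add exp_of_nat_mult) (simp add: field_simps)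
      then show ?thesis unfolding c_def b_def by (simp add: mult_ac)
    qed
    finally show "ennreal (c k) * (\<integral>\<^sup>+j. ennreal (a j) * indicator (A (s + real k)) j \<partial>count_space (A s)) \<le> ennreal (b * q ^ k)" .
  qed
  also have "\<dots> = ennreal (\<Sum>k. b * q ^ k)"
    using q b by (intro suminf_ennreal2 summable_mult summable_geometric) auto
  also have "(\<Sum>k. b * q ^ k) = b / (1 - q)"
    using q by (subst suminf_mult) (auto simp: suminf_geometric summable_geometric)
  finally show ?thesis unfolding A_def b_def q_def by simp
qed

text \<open>Uniformly small tails replace the summable majorant of dominated convergence: the diameters of the branch
  domains of a convergent family need not be dominated by one summable sequence.\<close>
lemma tendsto_nn_integral_uniform_tails:
  fixes F :: "nat \<Rightarrow> nat \<Rightarrow> ennreal"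
  assumes lim: "\<And>j. j \<in> J \<Longrightarrow> (\<lambda>k. F k j) \<longlonglongrightarrow> G j"
    and tail: "\<And>\<eta>::real. \<eta> > 0 \<Longrightarrow> \<exists>N. \<forall>k. (\<integral>\<^sup>+j. F k j \<partial>count_space {j\<in>J. N \<le> j}) \<le> ennreal \<eta>"
  shows "(\<lambda>k. \<integral>\<^sup>+j. F k j \<partial>count_space J) \<longlonglongrightarrow> (\<integral>\<^sup>+j. G j \<partial>count_space J)"
proof -
  have inf: "(\<integral>\<^sup>+j. f j \<partial>count_space J) = (SUP A\<in>{A. finite A \<and> A \<subseteq> J}. sum f A)" for f :: "nat \<Rightarrow> ennreal"
    by (subst infsum_ennreal_eq_nn_integral[symmetric]) (auto intro: nonneg_infsum_complete)
  have sum_le: "sum f A \<le> (\<integral>\<^sup>+j. f j \<partial>count_space J)" if "finite A" "A \<subseteq> J" for f :: "nat \<Rightarrow> ennreal" and A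
    unfolding inf using that by (intro SUP_upper) auto
  have split: "(\<integral>\<^sup>+j. f j \<partial>count_space J) = sum f (J \<inter> {..<N}) + (\<integral>\<^sup>+j. f j \<partial>count_space {j\<in>J. N \<le> j})"
    for f :: "nat \<Rightarrow> ennreal" and N
  proof -
    have "(\<integral>\<^sup>+j. f j \<partial>count_space J)
       = (\<integral>\<^sup>+j. f j * indicator (J \<inter> {..<N}) j + f j * indicator {j\<in>J. N \<le> j} j \<partial>count_space J)"
      by (intro nn_integral_cong) (auto split: split_indicator)
    also have "\<dots> = (\<integral>\<^sup>+j. f j * indicator (J \<inter> {..<N}) j \<partial>count_space J) + (\<integral>\<^sup>+j. f j * indicator {j\<in>J. N \<le> j} j \<partial>count_space J)"
      by (rule nn_integral_add) auto
    also have "(\<integral>\<^sup>+j. f j * indicator (J \<inter> {..<N}) j \<partial>count_space J) = (\<integral>\<^sup>+j. f j * indicator (J \<inter> {..<N}) j \<partial>count_space (J \<inter> {..<N}))"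
      by (intro nn_integral_count_space_eq) auto
    also have "\<dots> = sum f (J \<inter> {..<N})" by (subst nn_integral_count_space_finite) auto
    also have "(\<integral>\<^sup>+j. f j * indicator {j\<in>J. N \<le> j} j \<partial>count_space J) = (\<integral>\<^sup>+j. f j * indicator {j\<in>J. N \<le> j} j \<partial>count_space {j\<in>J. N \<le> j})"
      by (intro nn_integral_count_space_eq) auto
    also have "\<dots> = (\<integral>\<^sup>+j. f j \<partial>count_space {j\<in>J. N \<le> j})" by (intro nn_integral_cong) auto
    finally show ?thesis .
  qed
  have fin_lim: "(\<lambda>k. sum (F k) A) \<longlonglongrightarrow> sum G A" if "A \<subseteq> J" for A
    by (intro tendsto_sum) (use lim that in auto)
  show ?thesis
  proof (rule order_tendstoI)
    fix x assume "x < (\<integral>\<^sup>+j. G j \<partial>count_space J)"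
    then obtain A where A: "finite A" "A \<subseteq> J" "x < sum G A" unfolding inf less_SUP_iff by auto
    from order_tendstoD(1)[OF fin_lim[OF A(2)] A(3)]
    show "\<forall>\<^sub>F k in sequentially. x < (\<integral>\<^sup>+j. F k j \<partial>count_space J)"
      by eventually_elim (use sum_le[OF A(1,2)] in \<open>auto intro: less_le_trans\<close>)
  next
    fix x assume x: "(\<integral>\<^sup>+j. G j \<partial>count_space J) < x"
    have "(\<lambda>n. (\<integral>\<^sup>+j. G j \<partial>count_space J) + ennreal (1 / real (Suc n))) \<longlonglongrightarrow> (\<integral>\<^sup>+j. G j \<partial>count_space J) + ennreal 0"
      by (intro tendsto_add tendsto_const tendsto_ennrealI LIMSEQ_Suc[OF lim_1_over_n])
    then have "\<forall>\<^sub>F n in sequentially. (\<integral>\<^sup>+j. G j \<partial>count_space J) + ennreal (1 / real (Suc n)) < x"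
      using x by (intro order_tendstoD(2)) auto
    then obtain n where n: "(\<integral>\<^sup>+j. G j \<partial>count_space J) + ennreal (1 / real (Suc n)) < x"
      by (auto simp: eventually_sequentially)
    define \<eta> where "\<eta> = 1 / real (Suc n)"
    have "\<eta> > 0" unfolding \<eta>_def by simp
    then obtain N where N: "\<And>k. (\<integral>\<^sup>+j. F k j \<partial>count_space {j\<in>J. N \<le> j}) \<le> ennreal \<eta>" using tail by blast
    have "sum G (J \<inter> {..<N}) + ennreal \<eta> \<le> (\<integral>\<^sup>+j. G j \<partial>count_space J) + ennreal \<eta>"
      by (intro add_right_mono sum_le) auto
    also have "\<dots> < x" using n unfolding \<eta>_def .
    finally have "sum G (J \<inter> {..<N}) + ennreal \<eta> < x" .
    moreover have "(\<lambda>k. sum (F k) (J \<inter> {..<N}) + ennreal \<eta>) \<longlonglongrightarrow> sum G (J \<inter> {..<N}) + ennreal \<eta>"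
      by (intro tendsto_add tendsto_const fin_lim) auto
    ultimately have "\<forall>\<^sub>F k in sequentially. sum (F k) (J \<inter> {..<N}) + ennreal \<eta> < x"
      by (rule order_tendstoD(2)[rotated])
    then show "\<forall>\<^sub>F k in sequentially. (\<integral>\<^sup>+j. F k j \<partial>count_space J) < x"
    proof eventually_elim
      case (elim k)
      have "(\<integral>\<^sup>+j. F k j \<partial>count_space J) \<le> sum (F k) (J \<inter> {..<N}) + ennreal \<eta>"
        unfolding split[of "F k" N] by (intro add_left_mono N)
      with elim show ?case by simp
    qed
  qed
qed

section \<open>Limits of normal sequences\<close>

lemma uniform_limit_at_moving_point:
  fixes F :: "nat \<Rightarrow> 'a::metric_space \<Rightarrow> 'b::metric_space"
  assumes F: "uniform_limit Q F g sequentially" and g: "continuous_on Q g"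
    and u: "\<forall>\<^sub>F k in sequentially. u k \<in> Q" "u \<longlonglongrightarrow> w" "w \<in> Q"
  shows "(\<lambda>k. F k (u k)) \<longlonglongrightarrow> g w"
proof -
  have gu: "(\<lambda>k. g (u k)) \<longlonglongrightarrow> g w"
    by (rule continuous_on_tendsto_compose[OF g u(2) u(3) u(1)])
  show ?thesis
  proof (rule tendstoI)
    fix e :: real assume e: "e > 0"
    have "\<forall>\<^sub>F k in sequentially. \<forall>z\<in>Q. dist (F k z) (g z) < e/2" by (rule uniform_limitD[OF F]) (use e in simp)
    moreover have "\<forall>\<^sub>F k in sequentially. dist (g (u k)) (g w) < e/2" by (rule tendstoD[OF gu]) (use e in simp)
    ultimately show "\<forall>\<^sub>F k in sequentially. dist (F k (u k)) (g w) < e"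
      using u(1)
    proof eventually_elim
      case (elim k)
      have "dist (F k (u k)) (g w) \<le> dist (F k (u k)) (g (u k)) + dist (g (u k)) (g w)" by (rule dist_triangle)
      moreover have "dist (F k (u k)) (g (u k)) < e/2" using elim by blast
      ultimately show ?case using elim by linarith
    qed
  qed
qed

text \<open>A Vitali type theorem. Convergence is only assumed along points \<open>u k\<close> that move with \<open>k\<close>, which is all that
  Hausdorff convergence of the branch domains provides. By Montel's theorem any subsequence has a locally uniformly
  convergent subsequence; its limit agrees with \<open>f0\<close> on \<open>W\<close> and so on \<open>S\<close>.\<close>
lemma normal_sequence_convergence:
  fixes f :: "nat \<Rightarrow> complex \<Rightarrow> complex"
  assumes S: "open S" "connected S" and f: "\<And>k. f k holomorphic_on S" and f0: "f0 holomorphic_on S"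
    and bounded: "\<And>Q. compact Q \<Longrightarrow> Q \<subseteq> S \<Longrightarrow> \<exists>B. \<forall>k. \<forall>z\<in>Q. norm (f k z) \<le> B"
    and W: "open W" "W \<noteq> {}" "W \<subseteq> S"
    and near: "\<And>w. w \<in> W \<Longrightarrow> \<exists>u. u \<longlonglongrightarrow> w \<and> (\<lambda>k. f k (u k)) \<longlonglongrightarrow> f0 w"
    and Q: "compact Q" "Q \<subseteq> S"
  shows "uniform_limit Q f f0 sequentially"
proof (rule ccontr)
  assume "\<not> ?thesis"
  then obtain e where e: "e > 0" "\<not> (\<forall>\<^sub>F k in sequentially. \<forall>z\<in>Q. dist (f k z) (f0 z) < e)"
    unfolding uniform_limit_iff by auto
  from e(2) have "infinite {k. \<not> (\<forall>z\<in>Q. dist (f k z) (f0 z) < e)}"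
    unfolding not_eventually frequently_cofinite[symmetric] cofinite_eq_sequentially .
  then obtain s :: "nat \<Rightarrow> nat" where s: "strict_mono s" "\<And>k. \<not> (\<forall>z\<in>Q. dist (f (s k) z) (f0 z) < e)"
    using infinite_enumerate by blast
  obtain g r where g: "g holomorphic_on S" and r: "strict_mono (r :: nat \<Rightarrow> nat)"
    and lim: "\<And>K. compact K \<Longrightarrow> K \<subseteq> S \<Longrightarrow> uniform_limit K ((\<lambda>k. f (s k)) \<circ> r) g sequentially"
  proof (rule Montel[of S "range f" "\<lambda>k. f (s k)"])
    show "\<exists>B. \<forall>h\<in>range f. \<forall>z\<in>K. norm (h z) \<le> B" if "compact K" "K \<subseteq> S" for K
      using bounded[OF that] by auto
  qed (use S f in auto)
  have sr: "strict_mono (s \<circ> r)" using s r by (intro strict_mono_o)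
  have gW: "g w = f0 w" if w: "w \<in> W" for w
  proof -
    obtain u where u: "u \<longlonglongrightarrow> w" "(\<lambda>k. f k (u k)) \<longlonglongrightarrow> f0 w" using near[OF w] by auto
    obtain \<rho> where \<rho>: "\<rho> > 0" "cball w \<rho> \<subseteq> S" using S(1) w W(3) by (meson open_contains_cball subsetD)
    have u': "(u \<circ> (s \<circ> r)) \<longlonglongrightarrow> w" by (rule LIMSEQ_subseq_LIMSEQ[OF u(1) sr])
    have "\<forall>\<^sub>F k in sequentially. (u \<circ> (s \<circ> r)) k \<in> cball w \<rho>"
      using tendstoD[OF u' \<rho>(1)] by eventually_elim (auto simp: dist_commute)
    moreover have "continuous_on (cball w \<rho>) g"
      using g \<rho>(2) holomorphic_on_imp_continuous_on holomorphic_on_subset by blast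
    moreover have "w \<in> cball w \<rho>" using \<rho>(1) by simp
    ultimately have "(\<lambda>k. ((\<lambda>k. f (s k)) \<circ> r) k ((u \<circ> (s \<circ> r)) k)) \<longlonglongrightarrow> g w"
      using uniform_limit_at_moving_point[OF lim[OF compact_cball \<rho>(2)]] u' by blast
    moreover have "(\<lambda>k. ((\<lambda>k. f (s k)) \<circ> r) k ((u \<circ> (s \<circ> r)) k)) \<longlonglongrightarrow> f0 w"
      using LIMSEQ_subseq_LIMSEQ[OF u(2) sr] by (simp add: o_def)
    ultimately show ?thesis by (rule LIMSEQ_unique)
  qed
  have "g z = f0 z" if "z \<in> S" for z
    by (rule analytic_continuation_open[OF W(1) S(1) W(2) S(2) W(3) g f0 gW that])
  then have "uniform_limit Q ((\<lambda>k. f (s k)) \<circ> r) f0 sequentially"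
    using lim[OF Q] Q(2) by (subst uniform_limit_cong'[where g = "(\<lambda>k. f (s k)) \<circ> r" and i = g]) auto
  then have "\<forall>\<^sub>F k in sequentially. \<forall>z\<in>Q. dist (f (s (r k)) z) (f0 z) < e"
    using e(1) by (simp add: uniform_limit_iff o_def)
  then show False using s(2) by (auto simp: eventually_sequentially)
qed

lemma holomorphic_limit_at_moving_point:
  fixes f :: "nat \<Rightarrow> complex \<Rightarrow> complex"
  assumes S: "open S" and f: "\<And>k. f k holomorphic_on S" and f0: "f0 holomorphic_on S"
    and lim: "\<And>Q. compact Q \<Longrightarrow> Q \<subseteq> S \<Longrightarrow> uniform_limit Q f f0 sequentially"
    and x: "x \<longlonglongrightarrow> x0" "x0 \<in> S"
  shows "(\<lambda>k. f k (x k)) \<longlonglongrightarrow> f0 x0" "(\<lambda>k. deriv (f k) (x k)) \<longlonglongrightarrow> deriv f0 x0"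
proof -
  obtain r where r: "r > 0" "cball x0 r \<subseteq> S" using S x(2) by (meson open_contains_cball)
  have ev: "\<forall>\<^sub>F k in sequentially. x k \<in> ball x0 (r/2)"
    using tendstoD[OF x(1), of "r/2"] r(1) by (auto simp: dist_commute)
  have ul: "uniform_limit (cball x0 r) f f0 sequentially" using lim r by auto
  show "(\<lambda>k. f k (x k)) \<longlonglongrightarrow> f0 x0"
  proof (rule uniform_limit_at_moving_point[OF ul])
    show "continuous_on (cball x0 r) f0"
      using f0 r by (auto intro: holomorphic_on_imp_continuous_on holomorphic_on_subset)
    show "\<forall>\<^sub>F k in sequentially. x k \<in> cball x0 r" using ev by eventually_elim (use r in auto)
  qed (use x r in auto)
  have "uniform_limit (ball x0 (r/2)) (\<lambda>k. deriv (f k)) (deriv f0) sequentially"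
  proof (rule uniform_limitI)
    fix e :: real assume e: "e > 0"
    have "\<forall>\<^sub>F k in sequentially. \<forall>z\<in>cball x0 r. dist (f k z) (f0 z) < e * r / 8"
      by (rule uniform_limitD[OF ul]) (use e r(1) in simp)
    then show "\<forall>\<^sub>F k in sequentially. \<forall>z\<in>ball x0 (r/2). dist (deriv (f k) z) (deriv f0 z) < e"
    proof (eventually_elim, intro ballI)
      fix k z assume b: "\<forall>z\<in>cball x0 r. dist (f k z) (f0 z) < e * r / 8" and z: "z \<in> ball x0 (r/2)"
      have "ball z (r/2) \<subseteq> ball x0 r"
        using z dist_triangle[of x0 _ z] by (auto simp: dist_commute) (smt (verit) dist_commute dist_triangle field_sum_of_halves)
      then have zQ: "ball z (r/2) \<subseteq> cball x0 r" using ball_subset_cball by blast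
      then have zS: "ball z (r/2) \<subseteq> S" using r(2) by blast
      moreover have "z \<in> ball z (r/2)" using r(1) by simp
      ultimately have "z \<in> S" by blast
      have "norm (deriv (\<lambda>w. f k w - f0 w) z) \<le> (e * r / 8) / (r/4)"
      proof (rule Cauchy_deriv_bound[where c = 0])
        show "(\<lambda>w. f k w - f0 w) holomorphic_on ball z (r/2)"
          using zS f f0 by (intro holomorphic_intros) (auto intro: holomorphic_on_subset)
        fix w assume "norm (w - z) = r / 4"
        then have "w \<in> ball z (r/2)" using r(1) by (simp add: dist_norm norm_minus_commute)
        then show "norm (f k w - f0 w - 0) \<le> e * r / 8" using b zQ by (force simp: dist_norm)
      qed (use r in auto)
      also have "\<dots> < e" using e r by simp
      also have "deriv (\<lambda>w. f k w - f0 w) z = deriv (f k) z - deriv f0 z"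
        using S f f0 \<open>z \<in> S\<close> by (intro deriv_diff) (auto intro: holomorphic_on_imp_differentiable_at)
      finally show "dist (deriv (f k) z) (deriv f0 z) < e" by (simp add: dist_norm)
    qed
  qed
  then show "(\<lambda>k. deriv (f k) (x k)) \<longlonglongrightarrow> deriv f0 x0"
  proof (rule uniform_limit_at_moving_point[OF _ _ ev x(1)])
    have "deriv f0 holomorphic_on S" using f0 S by (rule holomorphic_deriv)
    moreover have "ball x0 (r/2) \<subseteq> S" using r by auto
    ultimately show "continuous_on (ball x0 (r/2)) (deriv f0)"
      by (auto intro: holomorphic_on_imp_continuous_on holomorphic_on_subset)
  qed (use r in auto)
qed

section \<open>Families with uniform bounds\<close>

text \<open>
  The uniform estimates on which the continuity of the pressure rests, collected for a set \<open>E\<close> of parameters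
  already restricted to a neighbourhood of \<open>0\<close>. Here \<open>\<psi> \<epsilon> j\<close> is the extended inverse branch, \<open>a \<epsilon> j\<close> stands for the
  diameter of the branch domain, and none of the constants \<open>M\<close>, \<open>c\<close>, \<open>C\<close>, \<open>\<kappa>\<close>, \<open>L\<close> depends on \<open>\<epsilon>\<close>.\<close>
locale repeller_family =
  fixes E :: "complex set" and J :: "nat set" and Dj :: "complex \<Rightarrow> nat \<Rightarrow> complex set"
    and D :: "complex \<Rightarrow> complex set" and \<phi> :: "complex \<Rightarrow> complex \<Rightarrow> complex"
    and S :: "complex set" and \<psi> :: "complex \<Rightarrow> nat \<Rightarrow> complex \<Rightarrow> complex"
    and a :: "complex \<Rightarrow> nat \<Rightarrow> real" and M c C \<kappa> L :: real
  assumes zero_in_E: "0 \<in> E"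
    and repeller: "\<epsilon> \<in> E \<Longrightarrow> generalised_Cantor_repeller J (Dj \<epsilon>) (D \<epsilon>) (\<phi> \<epsilon>)"
    and zero_in_D: "\<epsilon> \<in> E \<Longrightarrow> 0 \<in> D \<epsilon>"
    and open_S: "open S" and D_subset: "\<epsilon> \<in> E \<Longrightarrow> D \<epsilon> \<subseteq> S"
    and branch: "\<epsilon> \<in> E \<Longrightarrow> j \<in> J \<Longrightarrow> \<psi> \<epsilon> j holomorphic_on S" "\<epsilon> \<in> E \<Longrightarrow> j \<in> J \<Longrightarrow> inj_on (\<psi> \<epsilon> j) S"
      "\<epsilon> \<in> E \<Longrightarrow> j \<in> J \<Longrightarrow> \<psi> \<epsilon> j ` S \<subseteq> S"
    and branch_inverse: "\<epsilon> \<in> E \<Longrightarrow> j \<in> J \<Longrightarrow> w \<in> D \<epsilon> \<Longrightarrow> \<psi> \<epsilon> j w = inv_into (Dj \<epsilon> j) (\<phi> \<epsilon>) w"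
    and M_ge_1: "M \<ge> 1"
    and distortion: "\<epsilon> \<in> E \<Longrightarrow> f holomorphic_on S \<Longrightarrow> inj_on f S \<Longrightarrow> x \<in> D \<epsilon> \<Longrightarrow> y \<in> D \<epsilon> \<Longrightarrow>
        norm (deriv f x) \<le> M * norm (deriv f y)"
    and c_ge_1: "c \<ge> 1"
    and deriv_le: "\<epsilon> \<in> E \<Longrightarrow> j \<in> J \<Longrightarrow> x \<in> D \<epsilon> \<Longrightarrow> norm (deriv (\<psi> \<epsilon> j) x) \<le> c * a \<epsilon> j"
    and a_nonneg: "\<epsilon> \<in> E \<Longrightarrow> j \<in> J \<Longrightarrow> 0 \<le> a \<epsilon> j" and a_le: "\<epsilon> \<in> E \<Longrightarrow> j \<in> J \<Longrightarrow> a \<epsilon> j \<le> L"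
    and L_ge_1: "L \<ge> 1" and \<kappa>_pos: "\<kappa> > 0" and C_nonneg: "C \<ge> 0"
    and tails: "\<epsilon> \<in> E \<Longrightarrow>
        (\<integral>\<^sup>+j. ennreal (a \<epsilon> j) \<partial>count_space {j\<in>J. a \<epsilon> j < exp (- s)}) \<le> ennreal (C * exp (- s * \<kappa>))"
    and uniformly_small: "\<eta> > 0 \<Longrightarrow> \<exists>N. \<forall>\<epsilon>\<in>E. \<forall>j\<in>J. N \<le> j \<longrightarrow> a \<epsilon> j < \<eta>"
    and branch_limit: "range e \<subseteq> E \<Longrightarrow> e \<longlonglongrightarrow> 0 \<Longrightarrow> j \<in> J \<Longrightarrow> u \<longlonglongrightarrow> x0 \<Longrightarrow> x0 \<in> D 0 \<Longrightarrow>
        (\<lambda>k. \<psi> (e k) j (u k)) \<longlonglongrightarrow> \<psi> 0 j x0 \<and> (\<lambda>k. deriv (\<psi> (e k) j) (u k)) \<longlonglongrightarrow> deriv (\<psi> 0 j) x0"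
begin

abbreviation Z :: "complex \<Rightarrow> real \<Rightarrow> nat \<Rightarrow> complex \<Rightarrow> ennreal" where
  "Z \<epsilon> t \<equiv> partition_sum J (\<psi> \<epsilon>) t"

text \<open>Half the rate \<open>\<kappa>\<close> is reserved for the geometric series in the tail estimate; the bound \<open>1/2\<close> keeps \<open>t\<close> nonnegative
  and bounded.\<close>
definition admissible :: "real \<Rightarrow> bool" where
  "admissible t \<longleftrightarrow> \<bar>t - 1\<bar> \<le> min (\<kappa> / 2) (1 / 2)"

lemma admissible_bounds:
  assumes "admissible t" shows "\<bar>t - 1\<bar> \<le> \<kappa> / 2" "0 \<le> t" "t \<le> 2"
proof -
  have "\<bar>t - 1\<bar> \<le> 1 / 2" and 1: "\<bar>t - 1\<bar> \<le> \<kappa> / 2" using assms unfolding admissible_def by simp_all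
  then show "0 \<le> t" "t \<le> 2" by linarith+
  show "\<bar>t - 1\<bar> \<le> \<kappa> / 2" by (rule 1)
qed

lemma branch_maps_D: "\<epsilon> \<in> E \<Longrightarrow> j \<in> J \<Longrightarrow> x \<in> D \<epsilon> \<Longrightarrow> \<psi> \<epsilon> j x \<in> D \<epsilon>"
  using repeller_inverse_branch(2)[OF repeller] branch_inverse by metis

lemma weight_tail:
  "\<exists>B\<ge>0. \<forall>\<epsilon>\<in>E. \<forall>t x s. admissible t \<longrightarrow> x \<in> D \<epsilon> \<longrightarrow>
    (\<integral>\<^sup>+j. ennreal (norm (deriv (\<psi> \<epsilon> j) x) powr t) \<partial>count_space {j\<in>J. a \<epsilon> j < exp (- s)})
      \<le> ennreal (B * exp (- s * \<kappa> / 2))"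
proof -
  define b where "b = L powr \<kappa> * C * exp (\<kappa> / 2) / (1 - exp (- \<kappa> / 2))"
  have b: "b \<ge> 0" unfolding b_def using \<kappa>_pos C_nonneg by auto
  show ?thesis
  proof (intro exI[of _ "c\<^sup>2 * b"] conjI ballI allI impI)
    show "0 \<le> c\<^sup>2 * b" using b by simp
    fix \<epsilon> t x s assume \<epsilon>: "\<epsilon> \<in> E" and t: "admissible t" and x: "x \<in> D \<epsilon>"
    note t' = admissible_bounds[OF t]
    have "norm (deriv (\<psi> \<epsilon> j) x) powr t \<le> c\<^sup>2 * a \<epsilon> j powr t" if j: "j \<in> J" for j
    proof -
      have "norm (deriv (\<psi> \<epsilon> j) x) powr t \<le> (c * a \<epsilon> j) powr t"
        using deriv_le[OF \<epsilon> j x] t' by (intro powr_mono2) auto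
      also have "\<dots> = c powr t * a \<epsilon> j powr t"
        using a_nonneg[OF \<epsilon> j] c_ge_1 by (simp add: powr_mult)
      also have "c powr t \<le> c powr 2" using t' c_ge_1 by (intro powr_mono) auto
      then have "c powr t * a \<epsilon> j powr t \<le> c powr 2 * a \<epsilon> j powr t" by (intro mult_right_mono) auto
      finally show ?thesis using c_ge_1 by (simp add: powr_numeral)
    qed
    then have "(\<integral>\<^sup>+j. ennreal (norm (deriv (\<psi> \<epsilon> j) x) powr t) \<partial>count_space {j\<in>J. a \<epsilon> j < exp (- s)})
       \<le> (\<integral>\<^sup>+j. ennreal (c\<^sup>2) * ennreal (a \<epsilon> j powr t) \<partial>count_space {j\<in>J. a \<epsilon> j < exp (- s)})"
      by (intro nn_integral_mono) (auto simp flip: ennreal_mult)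
    also have "\<dots> = ennreal (c\<^sup>2) * (\<integral>\<^sup>+j. ennreal (a \<epsilon> j powr t) \<partial>count_space {j\<in>J. a \<epsilon> j < exp (- s)})"
      by (rule nn_integral_cmult) simp
    also have "\<dots> \<le> ennreal (c\<^sup>2) * ennreal (b * exp (- s * \<kappa> / 2))"
      unfolding b_def
      by (intro mult_left_mono nn_integral_power_tail a_nonneg[OF \<epsilon>] a_le[OF \<epsilon>] L_ge_1 \<kappa>_pos C_nonneg tails[OF \<epsilon>] t'(1)) auto
    also have "\<dots> = ennreal (c\<^sup>2 * b * exp (- s * \<kappa> / 2))" using b by (simp add: mult.assoc flip: ennreal_mult)
    finally show "(\<integral>\<^sup>+j. ennreal (norm (deriv (\<psi> \<epsilon> j) x) powr t) \<partial>count_space {j\<in>J. a \<epsilon> j < exp (- s)})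
       \<le> ennreal (c\<^sup>2 * b * exp (- s * \<kappa> / 2))" .
  qed
qed

lemma partition_sum_bound:
  "\<exists>B\<ge>0. \<forall>\<epsilon>\<in>E. \<forall>t x n. admissible t \<longrightarrow> x \<in> D \<epsilon> \<longrightarrow> Z \<epsilon> t n x \<le> ennreal (B ^ n)"
proof -
  obtain B0 where B0: "B0 \<ge> 0" "\<And>\<epsilon> t x s. \<epsilon> \<in> E \<Longrightarrow> admissible t \<Longrightarrow> x \<in> D \<epsilon> \<Longrightarrow>
    (\<integral>\<^sup>+j. ennreal (norm (deriv (\<psi> \<epsilon> j) x) powr t) \<partial>count_space {j\<in>J. a \<epsilon> j < exp (- s)})
      \<le> ennreal (B0 * exp (- s * \<kappa> / 2))" using weight_tail by blast
  \<comment> \<open>Below this threshold \<open>exp (- s) = L + 1\<close> lie all the indices.\<close>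
  define s where "s = - ln (L + 1)"
  have all: "{j\<in>J. a \<epsilon> j < exp (- s)} = J" if "\<epsilon> \<in> E" for \<epsilon>
    using a_le[OF that] L_ge_1 unfolding s_def by fastforce
  define B where "B = B0 * exp (- s * \<kappa> / 2)"
  have B: "B \<ge> 0" unfolding B_def using B0(1) by simp
  have step: "(\<integral>\<^sup>+j. ennreal (norm (deriv (\<psi> \<epsilon> j) x) powr t) \<partial>count_space J) \<le> ennreal B"
    if "\<epsilon> \<in> E" "admissible t" "x \<in> D \<epsilon>" for \<epsilon> t x
    using B0(2)[OF that, of s] unfolding all[OF that(1)] B_def .
  have "Z \<epsilon> t n x \<le> ennreal (B ^ n)" if \<epsilon>: "\<epsilon> \<in> E" and t: "admissible t" and x: "x \<in> D \<epsilon>" for \<epsilon> t x n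
    using x
  proof (induction n arbitrary: x)
    case (Suc n)
    have "Z \<epsilon> t (Suc n) x \<le> (\<integral>\<^sup>+j. ennreal (norm (deriv (\<psi> \<epsilon> j) x) powr t) * ennreal (B ^ n) \<partial>count_space J)"
      unfolding partition_sum.simps
      using Suc.IH[OF branch_maps_D[OF \<epsilon> _ Suc.prems]] by (intro nn_integral_mono) (auto intro!: mult_left_mono)
    also have "\<dots> = (\<integral>\<^sup>+j. ennreal (norm (deriv (\<psi> \<epsilon> j) x) powr t) \<partial>count_space J) * ennreal (B ^ n)"
      by (rule nn_integral_multc) simp
    also have "\<dots> \<le> ennreal B * ennreal (B ^ n)" using step[OF \<epsilon> t Suc.prems] by (rule mult_right_mono) simp
    finally show ?case using B by (simp flip: ennreal_mult)
  qed simp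
  then show ?thesis using B by blast
qed

lemma partition_sum_uniform_tail:
  assumes \<eta>: "\<eta> > 0"
  shows "\<exists>N. \<forall>\<epsilon>\<in>E. \<forall>t x. admissible t \<longrightarrow> x \<in> D \<epsilon> \<longrightarrow>
    (\<integral>\<^sup>+j. ennreal (norm (deriv (\<psi> \<epsilon> j) x) powr t) * Z \<epsilon> t n (\<psi> \<epsilon> j x) \<partial>count_space {j\<in>J. N \<le> j}) \<le> ennreal \<eta>"
proof -
  obtain B0 where B0: "B0 \<ge> 0" "\<And>\<epsilon> t x s. \<epsilon> \<in> E \<Longrightarrow> admissible t \<Longrightarrow> x \<in> D \<epsilon> \<Longrightarrow>
    (\<integral>\<^sup>+j. ennreal (norm (deriv (\<psi> \<epsilon> j) x) powr t) \<partial>count_space {j\<in>J. a \<epsilon> j < exp (- s)})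
      \<le> ennreal (B0 * exp (- s * \<kappa> / 2))" using weight_tail by blast
  obtain B where B: "B \<ge> 0" "\<And>\<epsilon> t x n. \<epsilon> \<in> E \<Longrightarrow> admissible t \<Longrightarrow> x \<in> D \<epsilon> \<Longrightarrow> Z \<epsilon> t n x \<le> ennreal (B ^ n)"
    using partition_sum_bound by blast
  define b where "b = B0 * B ^ n + 1"
  have b: "b > 0" unfolding b_def using B0(1) B(1) by (intro add_nonneg_pos) auto
  \<comment> \<open>Chosen so that \<open>exp (- s * \<kappa> / 2) = \<eta> / b\<close>; the summand \<open>1\<close> in \<open>b\<close> only keeps \<open>b\<close> positive.\<close>
  define s where "s = - (2 / \<kappa>) * ln (\<eta> / b)"
  have "exp (- s * \<kappa> / 2) = \<eta> / b" unfolding s_def using \<kappa>_pos \<eta> b by simp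
  then have "b * exp (- s * \<kappa> / 2) = \<eta>" using b by simp
  moreover have "b * exp (- s * \<kappa> / 2) = B0 * exp (- s * \<kappa> / 2) * B ^ n + exp (- s * \<kappa> / 2)"
    unfolding b_def by (simp only: algebra_simps)
  moreover have "exp (- s * \<kappa> / 2) \<ge> 0" by simp
  ultimately have s: "B0 * exp (- s * \<kappa> / 2) * B ^ n \<le> \<eta>" by linarith
  obtain N where N: "\<And>\<epsilon> j. \<epsilon> \<in> E \<Longrightarrow> j \<in> J \<Longrightarrow> N \<le> j \<Longrightarrow> a \<epsilon> j < exp (- s)"
    using uniformly_small[of "exp (- s)"] by auto
  show ?thesis
  proof (intro exI[of _ N] ballI allI impI)
    fix \<epsilon> t x assume \<epsilon>: "\<epsilon> \<in> E" and t: "admissible t" and x: "x \<in> D \<epsilon>"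
    let ?w = "\<lambda>j. ennreal (norm (deriv (\<psi> \<epsilon> j) x) powr t)"
    have "(\<integral>\<^sup>+j. ?w j * Z \<epsilon> t n (\<psi> \<epsilon> j x) \<partial>count_space {j\<in>J. N \<le> j})
       \<le> (\<integral>\<^sup>+j. ?w j * ennreal (B ^ n) \<partial>count_space {j\<in>J. N \<le> j})"
      using B(2)[OF \<epsilon> t branch_maps_D[OF \<epsilon> _ x]] by (intro nn_integral_mono) (auto intro!: mult_left_mono)
    also have "\<dots> = (\<integral>\<^sup>+j. ?w j \<partial>count_space {j\<in>J. N \<le> j}) * ennreal (B ^ n)"
      by (rule nn_integral_multc) simp
    also have "(\<integral>\<^sup>+j. ?w j \<partial>count_space {j\<in>J. N \<le> j}) = (\<integral>\<^sup>+j. ?w j * indicator {N..} j \<partial>count_space {j\<in>J. N \<le> j})"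
      by (intro nn_integral_cong) auto
    also have "\<dots> = (\<integral>\<^sup>+j. ?w j * indicator {N..} j \<partial>count_space {j\<in>J. a \<epsilon> j < exp (- s)})"
      using N[OF \<epsilon>] by (intro nn_integral_count_space_eq) auto
    also have "\<dots> \<le> (\<integral>\<^sup>+j. ?w j \<partial>count_space {j\<in>J. a \<epsilon> j < exp (- s)})"
      by (intro nn_integral_mono) (auto split: split_indicator)
    also have "\<dots> \<le> ennreal (B0 * exp (- s * \<kappa> / 2))" by (rule B0(2)[OF \<epsilon> t x])
    finally have "(\<integral>\<^sup>+j. ?w j * Z \<epsilon> t n (\<psi> \<epsilon> j x) \<partial>count_space {j\<in>J. N \<le> j}) \<le> ennreal (B0 * exp (- s * \<kappa> / 2)) * ennreal (B ^ n)"
      by (simp add: mult_right_mono)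
    also have "\<dots> \<le> ennreal \<eta>" using s B0(1) B(1) by (simp flip: ennreal_mult add: ennreal_leI)
    finally show "(\<integral>\<^sup>+j. ?w j * Z \<epsilon> t n (\<psi> \<epsilon> j x) \<partial>count_space {j\<in>J. N \<le> j}) \<le> ennreal \<eta>" .
  qed
qed

text \<open>The base point has to move: in the induction step \<open>x\<close> is replaced by \<open>\<psi> (e k) j (x k)\<close>, which depends on \<open>k\<close>.\<close>
lemma partition_sum_tendsto:
  assumes e: "range e \<subseteq> E" "e \<longlonglongrightarrow> 0" and t: "\<And>k. admissible (t k)" "t \<longlonglongrightarrow> t0"
    and x: "\<And>k. x k \<in> D (e k)" "x \<longlonglongrightarrow> x0" "x0 \<in> D 0"
  shows "(\<lambda>k. Z (e k) (t k) n (x k)) \<longlonglongrightarrow> Z 0 t0 n x0"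
  using x
proof (induction n arbitrary: x x0)
  case (Suc n)
  have ek: "e k \<in> E" for k using e by auto
  show ?case
    unfolding partition_sum.simps
  proof (rule tendsto_nn_integral_uniform_tails)
    fix j assume j: "j \<in> J"
    note lim = branch_limit[OF e j Suc.prems(2,3)]
    have "(\<lambda>k. Z (e k) (t k) n (\<psi> (e k) j (x k))) \<longlonglongrightarrow> Z 0 t0 n (\<psi> 0 j x0)"
      by (rule Suc.IH) (use branch_maps_D ek zero_in_E j Suc.prems lim in auto)
    moreover have "deriv (\<psi> 0 j) x0 \<noteq> 0"
      by (rule holomorphic_injective_imp_regular[OF branch(1)[OF zero_in_E j] open_S branch(2)[OF zero_in_E j]])
        (use D_subset[OF zero_in_E] Suc.prems(3) in auto)
    then have "(\<lambda>k. norm (deriv (\<psi> (e k) j) (x k)) powr t k) \<longlonglongrightarrow> norm (deriv (\<psi> 0 j) x0) powr t0"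
      by (intro tendsto_powr tendsto_norm conjunct2[OF lim] t(2)) auto
    then have "(\<lambda>k. ennreal (norm (deriv (\<psi> (e k) j) (x k)) powr t k)) \<longlonglongrightarrow> ennreal (norm (deriv (\<psi> 0 j) x0) powr t0)"
      by (rule tendsto_ennrealI)
    ultimately show "(\<lambda>k. ennreal (norm (deriv (\<psi> (e k) j) (x k)) powr t k) * Z (e k) (t k) n (\<psi> (e k) j (x k)))
       \<longlonglongrightarrow> ennreal (norm (deriv (\<psi> 0 j) x0) powr t0) * Z 0 t0 n (\<psi> 0 j x0)"
      using \<open>deriv (\<psi> 0 j) x0 \<noteq> 0\<close> by (intro tendsto_mult_ennreal) auto
  next
    fix \<eta> :: real assume "\<eta> > 0"
    from partition_sum_uniform_tail[OF this, of n]
    show "\<exists>N. \<forall>k. (\<integral>\<^sup>+j. ennreal (norm (deriv (\<psi> (e k) j) (x k)) powr t k) * Z (e k) (t k) n (\<psi> (e k) j (x k))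
        \<partial>count_space {j\<in>J. N \<le> j}) \<le> ennreal \<eta>"
      using ek t(1) Suc.prems(1) by meson
  qed
qed simp

lemma partition_sum_pos:
  assumes \<epsilon>: "\<epsilon> \<in> E" and x: "x \<in> D \<epsilon>"
  shows "0 < Z \<epsilon> t n x"
  using x
proof (induction n arbitrary: x)
  case (Suc n)
  obtain j where j: "j \<in> J" using repeller[OF \<epsilon>] unfolding generalised_Cantor_repeller_def by auto
  have "deriv (\<psi> \<epsilon> j) x \<noteq> 0"
    by (rule holomorphic_injective_imp_regular[OF branch(1)[OF \<epsilon> j] open_S branch(2)[OF \<epsilon> j]])
      (use D_subset[OF \<epsilon>] Suc.prems in auto)
  then have "0 < ennreal (norm (deriv (\<psi> \<epsilon> j) x) powr t) * Z \<epsilon> t n (\<psi> \<epsilon> j x)"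
    using Suc.IH[OF branch_maps_D[OF \<epsilon> j Suc.prems]] by (simp add: ennreal_zero_less_mult_iff)
  also have "\<dots> \<le> Z \<epsilon> t (Suc n) x"
    unfolding partition_sum.simps by (rule nn_integral_ge_point[OF j])
  finally show ?case .
qed simp

text \<open>The real number to which the sequence defining the pressure converges. For admissible
  \<open>t\<close> it exists by \<open>pressure_seq_tendsto\<close>, whose error bound is built in because the proof of continuity needs it.\<close>
definition P :: "complex \<Rightarrow> real \<Rightarrow> real" where
  "P \<epsilon> t = (SOME p. pressure_seq (\<Union>j\<in>J. Dj \<epsilon> j) (\<phi> \<epsilon>) t \<longlonglongrightarrow> ereal p \<and>
      (\<forall>n>0. \<bar>ln (enn2real (Z \<epsilon> t n 0)) / n - p\<bar> \<le> t * ln M / n))"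

lemma partition_sum_finite: "\<epsilon> \<in> E \<Longrightarrow> admissible t \<Longrightarrow> x \<in> D \<epsilon> \<Longrightarrow> Z \<epsilon> t n x < \<infinity>"
  using partition_sum_bound by (metis ennreal_less_top infinity_ennreal_def order_le_less_trans)

lemma P_bounds:
  assumes \<epsilon>: "\<epsilon> \<in> E" and t: "admissible t"
  shows "pressure_seq (\<Union>j\<in>J. Dj \<epsilon> j) (\<phi> \<epsilon>) t \<longlonglongrightarrow> ereal (P \<epsilon> t)"
    "n > 0 \<Longrightarrow> \<bar>ln (enn2real (Z \<epsilon> t n 0)) / n - P \<epsilon> t\<bar> \<le> 2 * ln M / n"
proof -
  note t' = admissible_bounds(2,3)[OF t]
  have "\<exists>p. pressure_seq (\<Union>j\<in>J. Dj \<epsilon> j) (\<phi> \<epsilon>) t \<longlonglongrightarrow> ereal p \<and>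
      (\<forall>n>0. \<bar>ln (enn2real (Z \<epsilon> t n 0)) / n - p\<bar> \<le> t * ln M / n)"
    by (rule pressure_seq_tendsto[OF repeller[OF \<epsilon>] zero_in_D[OF \<epsilon>] open_S D_subset[OF \<epsilon>] distortion[OF \<epsilon>] M_ge_1])
      (use branch[OF \<epsilon>] branch_inverse[OF \<epsilon>] t' partition_sum_pos[OF \<epsilon> zero_in_D[OF \<epsilon>]]
        partition_sum_finite[OF \<epsilon> t zero_in_D[OF \<epsilon>]] in auto)
  then have *: "pressure_seq (\<Union>j\<in>J. Dj \<epsilon> j) (\<phi> \<epsilon>) t \<longlonglongrightarrow> ereal (P \<epsilon> t) \<and>
      (\<forall>n>0. \<bar>ln (enn2real (Z \<epsilon> t n 0)) / n - P \<epsilon> t\<bar> \<le> t * ln M / n)"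
    unfolding P_def by (rule someI_ex)
  then show "pressure_seq (\<Union>j\<in>J. Dj \<epsilon> j) (\<phi> \<epsilon>) t \<longlonglongrightarrow> ereal (P \<epsilon> t)" by simp
  assume n: "n > 0"
  have "t * ln M / n \<le> 2 * ln M / n" using t' M_ge_1 by (intro divide_right_mono mult_right_mono) auto
  moreover have "\<bar>ln (enn2real (Z \<epsilon> t n 0)) / n - P \<epsilon> t\<bar> \<le> t * ln M / n" using * n by blast
  ultimately show "\<bar>ln (enn2real (Z \<epsilon> t n 0)) / n - P \<epsilon> t\<bar> \<le> 2 * ln M / n" by linarith
qed

text \<open>An interchange of limits: the \<open>n\<close>-th approximation to the pressure has an error \<open>2 * ln M / n\<close> uniform in
  \<open>\<epsilon>\<close> and \<open>t\<close>, and for fixed \<open>n\<close> it depends continuously on them.\<close>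
lemma P_tendsto:
  assumes e: "range e \<subseteq> E" "e \<longlonglongrightarrow> 0" and t: "\<And>k. admissible (t k)" "t \<longlonglongrightarrow> t0"
  shows "(\<lambda>k. P (e k) (t k)) \<longlonglongrightarrow> P 0 t0"
proof (rule tendstoI)
  fix \<eta> :: real assume \<eta>: "\<eta> > 0"
  have ek: "e k \<in> E" for k using e by auto
  have t0: "admissible t0"
    unfolding admissible_def
  proof (rule tendsto_upperbound)
    show "(\<lambda>k. \<bar>t k - 1\<bar>) \<longlonglongrightarrow> \<bar>t0 - 1\<bar>" by (intro tendsto_intros t)
  qed (use t(1) in \<open>auto simp: admissible_def\<close>)
  have "(\<lambda>n. 2 * ln M / real n) \<longlonglongrightarrow> 0" by (rule lim_const_over_n)
  then have "\<forall>\<^sub>F n in sequentially. 2 * ln M / real n < \<eta> / 4"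
    by (rule order_tendstoD(2)) (use \<eta> in simp)
  then have "\<forall>\<^sub>F n in sequentially. 2 * ln M / real n < \<eta> / 4 \<and> n > 0"
    using eventually_gt_at_top[of 0] by (rule eventually_conj)
  then obtain n :: nat where n: "2 * ln M / real n < \<eta> / 4" "n > 0" by (auto simp: eventually_sequentially)
  define l where "l \<epsilon> t = ln (enn2real (Z \<epsilon> t n 0)) / real n" for \<epsilon> t
  have fin: "0 < Z 0 t0 n 0" "Z 0 t0 n 0 < \<infinity>"
    using partition_sum_pos[OF zero_in_E zero_in_D[OF zero_in_E]] partition_sum_finite[OF zero_in_E t0 zero_in_D[OF zero_in_E]]
    by auto
  have "(\<lambda>k. enn2real (Z (e k) (t k) n 0)) \<longlonglongrightarrow> enn2real (Z 0 t0 n 0)"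
    by (rule tendsto_enn2real) (use partition_sum_tendsto[OF e t, of "\<lambda>_. 0" 0] zero_in_D ek zero_in_E fin in auto)
  then have "(\<lambda>k. l (e k) (t k)) \<longlonglongrightarrow> l 0 t0"
    unfolding l_def using fin n by (intro tendsto_divide tendsto_ln tendsto_const) (auto simp: enn2real_eq_0_iff)
  from tendstoD[OF this, of "\<eta>/4"] \<eta>
  have "\<forall>\<^sub>F k in sequentially. dist (l (e k) (t k)) (l 0 t0) < \<eta> / 4" by simp
  then show "\<forall>\<^sub>F k in sequentially. dist (P (e k) (t k)) (P 0 t0) < \<eta>"
  proof eventually_elim
    case (elim k)
    have "\<bar>l (e k) (t k) - P (e k) (t k)\<bar> < \<eta>/4" "\<bar>l 0 t0 - P 0 t0\<bar> < \<eta>/4"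
      using P_bounds(2)[OF ek[of k] t(1)[of k] n(2)] P_bounds(2)[OF zero_in_E t0 n(2)] n(1) unfolding l_def by simp_all
    then show ?case using elim unfolding dist_real_def by linarith
  qed
qed

text \<open>A violating sequence \<open>(e k, t k)\<close> has a subsequence along which \<open>t k\<close> converges. Joint continuity, applied to
  \<open>e\<close> and to the constant sequence \<open>0\<close>, gives the same limit for \<open>P (e k) (t k)\<close> and \<open>P 0 (t k)\<close>.\<close>
lemma pressure_uniform_limit:
  assumes \<eta>: "\<eta> > 0"
  shows "\<exists>\<rho>>0. \<forall>\<epsilon>\<in>E. norm \<epsilon> < \<rho> \<longrightarrow> (\<forall>t. admissible t \<longrightarrow> \<bar>P \<epsilon> t - P 0 t\<bar> < \<eta>)"
proof (rule ccontr)
  assume "\<not> ?thesis"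
  then have "\<forall>\<rho>>0. \<exists>\<epsilon> t. \<epsilon> \<in> E \<and> norm \<epsilon> < \<rho> \<and> admissible t \<and> \<bar>P \<epsilon> t - P 0 t\<bar> \<ge> \<eta>"
    by (meson not_less)
  then have "\<exists>\<epsilon> t. \<epsilon> \<in> E \<and> norm \<epsilon> < 1 / Suc k \<and> admissible t \<and> \<bar>P \<epsilon> t - P 0 t\<bar> \<ge> \<eta>" for k by auto
  then obtain e t where et: "\<And>k. e k \<in> E" "\<And>k. norm (e k) < 1 / Suc k" "\<And>k. admissible (t k)"
     "\<And>k. \<bar>P (e k) (t k) - P 0 (t k)\<bar> \<ge> \<eta>" by metis
  have e0: "e \<longlonglongrightarrow> 0"
    by (rule Lim_null_comparison[OF _ LIMSEQ_Suc[OF lim_1_over_n]]) (use et(2) in \<open>auto intro: always_eventually less_imp_le\<close>)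
  have "t k \<in> cball 1 (min (\<kappa>/2) (1/2))" for k
    using et(3)[of k] unfolding admissible_def by (auto simp: dist_real_def abs_minus_commute)
  then obtain t0 r where r: "strict_mono (r :: nat \<Rightarrow> nat)" "(t \<circ> r) \<longlonglongrightarrow> t0"
    using compact_cball[of "1::real" "min (\<kappa>/2) (1/2)"] unfolding compact_def by blast
  have 1: "(\<lambda>k. P ((e \<circ> r) k) ((t \<circ> r) k)) \<longlonglongrightarrow> P 0 t0"
  proof (rule P_tendsto)
    show "(e \<circ> r) \<longlonglongrightarrow> 0" by (rule LIMSEQ_subseq_LIMSEQ[OF e0 r(1)])
    show "(t \<circ> r) \<longlonglongrightarrow> t0" by (rule r(2))
  qed (use et in auto)
  have 2: "(\<lambda>k. P ((\<lambda>_. 0) k) ((t \<circ> r) k)) \<longlonglongrightarrow> P 0 t0"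
  proof (rule P_tendsto)
    show "(t \<circ> r) \<longlonglongrightarrow> t0" by (rule r(2))
  qed (use et zero_in_E in auto)
  have "(\<lambda>k. \<bar>P (e (r k)) (t (r k)) - P 0 (t (r k))\<bar>) \<longlonglongrightarrow> 0"
    using tendsto_rabs[OF tendsto_diff[OF 1 2]] by simp
  then have "\<forall>\<^sub>F k in sequentially. \<bar>P (e (r k)) (t (r k)) - P 0 (t (r k))\<bar> < \<eta>"
    using \<eta> by (rule order_tendstoD(2))
  then obtain k where "\<bar>P (e (r k)) (t (r k)) - P 0 (t (r k))\<bar> < \<eta>" by (auto simp: eventually_sequentially)
  then show False using et(4)[of "r k"] by simp
qed

end

section \<open>Consequences of Hausdorff convergence\<close>

lemma eventually_at_0_within_ball:
  assumes "\<forall>\<^sub>F \<epsilon> in at 0 within E. Q \<epsilon>" "Q (0 :: complex)"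
  shows "\<exists>\<rho>>0. \<forall>\<epsilon>\<in>E. norm \<epsilon> < \<rho> \<longrightarrow> Q \<epsilon>"
proof -
  obtain d where "d > 0" "\<forall>x\<in>E. x \<noteq> 0 \<and> dist x 0 < d \<longrightarrow> Q x" using assms(1) unfolding eventually_at by auto
  then show ?thesis using assms(2) by (intro exI[of _ d]) (metis dist_0_norm dist_commute)
qed

text \<open>The asymmetry is deliberate: the first part confines the domains to a neighbourhood of
  \<open>closure (A 0)\<close>, whereas the second one produces points of the open domains themselves.\<close>
lemma domains_convergeD:
  assumes conv: "domains_converge E A" and ne: "\<And>\<epsilon>. \<epsilon> \<in> E \<Longrightarrow> A \<epsilon> \<noteq> {}" "0 \<in> E" and \<eta>: "\<eta> > 0"
  shows "\<exists>\<rho>>0. \<forall>\<epsilon>\<in>E. norm \<epsilon> < \<rho> \<longrightarrow>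
    (\<forall>x\<in>A \<epsilon>. infdist x (closure (A 0)) < \<eta>) \<and> (\<forall>y\<in>A 0. \<exists>x\<in>A \<epsilon>. dist y x < \<eta>)"
proof -
  have "\<forall>\<^sub>F \<epsilon> in at 0 within E. hausdorff_edist (closure (A \<epsilon>)) (closure (A 0)) < ennreal \<eta>"
    by (rule order_tendstoD(2)[OF conv[unfolded domains_converge_def]]) (use \<eta> in simp)
  moreover have "hausdorff_edist (closure (A 0)) (closure (A 0)) < ennreal \<eta>"
  proof -
    have "hausdorff_edist (closure (A 0)) (closure (A 0)) \<le> 0"
      unfolding hausdorff_edist_def max.bounded_iff by (intro conjI SUP_least) simp_all
    also have "0 < ennreal \<eta>" using \<eta> by simp
    finally show ?thesis .
  qed
  ultimately obtain \<rho> where \<rho>: "\<rho> > 0"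
    "\<And>\<epsilon>. \<epsilon> \<in> E \<Longrightarrow> norm \<epsilon> < \<rho> \<Longrightarrow> hausdorff_edist (closure (A \<epsilon>)) (closure (A 0)) < ennreal \<eta>"
    using eventually_at_0_within_ball[where Q = "\<lambda>\<epsilon>. hausdorff_edist (closure (A \<epsilon>)) (closure (A 0)) < ennreal \<eta>"] by blast
  show ?thesis
  proof (intro exI[of _ \<rho>] conjI ballI impI \<rho>(1))
    fix \<epsilon> assume \<epsilon>: "\<epsilon> \<in> E" "norm \<epsilon> < \<rho>"
    note lt = \<rho>(2)[OF \<epsilon>, unfolded hausdorff_edist_def max_less_iff_conj]
    {
      fix x assume "x \<in> A \<epsilon>"
      then have "ennreal (infdist x (closure (A 0))) \<le> (SUP x\<in>closure (A \<epsilon>). ennreal (infdist x (closure (A 0))))"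
        using closure_subset by (intro SUP_upper) auto
      also have "\<dots> < ennreal \<eta>" using lt by simp
      finally show "infdist x (closure (A 0)) < \<eta>" by (simp add: ennreal_less_iff infdist_nonneg)
    }
    fix y assume "y \<in> A 0"
    then have "ennreal (infdist y (closure (A \<epsilon>))) \<le> (SUP y\<in>closure (A 0). ennreal (infdist y (closure (A \<epsilon>))))"
      using closure_subset by (intro SUP_upper) auto
    also have "\<dots> < ennreal \<eta>" using lt by simp
    finally have 1: "infdist y (closure (A \<epsilon>)) < \<eta>" by (simp add: ennreal_less_iff infdist_nonneg)
    obtain z where z: "z \<in> closure (A \<epsilon>)" "infdist y (closure (A \<epsilon>)) = dist y z"
      using infdist_attains_inf[of "closure (A \<epsilon>)" y] ne(1)[OF \<epsilon>(1)] by auto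
    then obtain x where x: "x \<in> A \<epsilon>" "dist z x < \<eta> - dist y z"
      using closure_approachableD[of z "A \<epsilon>" "\<eta> - dist y z"] 1 by auto
    then show "\<exists>x\<in>A \<epsilon>. dist y x < \<eta>" using dist_triangle[of y x z] by (intro bexI[of _ x]) auto
  qed
qed

lemma domains_converge_approximating_sequence:
  assumes conv: "domains_converge E A" and ne: "\<And>\<epsilon>. \<epsilon> \<in> E \<Longrightarrow> A \<epsilon> \<noteq> {}" "0 \<in> E"
    and e: "range e \<subseteq> E" "e \<longlonglongrightarrow> 0" and z: "z \<in> A 0"
  shows "\<exists>u. (\<forall>k. u k \<in> A (e k)) \<and> u \<longlonglongrightarrow> z"
proof -
  have ek: "e k \<in> E" for k using e by auto
  have "\<exists>x\<in>A (e k). dist z x < infdist z (A (e k)) + 1 / Suc k" for k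
  proof -
    have "(INF y\<in>A (e k). dist z y) < infdist z (A (e k)) + 1 / Suc k"
      using ne(1)[OF ek] by (simp add: infdist_def)
    then show ?thesis using cInf_lessD[of "dist z ` A (e k)"] ne(1)[OF ek] by auto
  qed
  then obtain u where u: "\<And>k. u k \<in> A (e k)" "\<And>k. dist z (u k) < infdist z (A (e k)) + 1 / Suc k" by metis
  have "(\<lambda>k. infdist z (A (e k))) \<longlonglongrightarrow> 0"
  proof (rule tendstoI)
    fix \<eta> :: real assume "\<eta> > 0"
    from domains_convergeD[OF conv ne this] obtain \<rho> where \<rho>: "\<rho> > 0"
      "\<And>\<epsilon>. \<epsilon> \<in> E \<Longrightarrow> norm \<epsilon> < \<rho> \<Longrightarrow> \<exists>x\<in>A \<epsilon>. dist z x < \<eta>" using z by blast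
    have "\<forall>\<^sub>F k in sequentially. norm (e k) < \<rho>" using tendstoD[OF e(2) \<rho>(1)] by simp
    then show "\<forall>\<^sub>F k in sequentially. dist (infdist z (A (e k))) 0 < \<eta>"
    proof eventually_elim
      case (elim k)
      then obtain x where "x \<in> A (e k)" "dist z x < \<eta>" using \<rho>(2)[OF ek] by auto
      then have "infdist z (A (e k)) < \<eta>" by (meson infdist_le le_less_trans)
      then show ?case by (simp add: dist_real_def infdist_nonneg)
    qed
  qed
  from tendsto_add[OF this LIMSEQ_Suc[OF lim_1_over_n]]
  have "(\<lambda>k. infdist z (A (e k)) + 1 / Suc k) \<longlonglongrightarrow> 0" by simp
  then have "(\<lambda>k. dist (u k) z) \<longlonglongrightarrow> 0"
    by (rule tendsto_sandwich[rotated 2, OF tendsto_const])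
      (use u(2) in \<open>auto simp: dist_commute intro!: always_eventually less_imp_le\<close>)
  then show ?thesis using u(1) tendsto_dist_iff by blast
qed

text \<open>For \<open>w \<in> D 0\<close> put \<open>z = \<psi> 0 w\<close>. Points \<open>u k\<close> of \<open>Dj (e k) j\<close> converging to \<open>z\<close> eventually lie in the open set
  \<open>Dj 0 j\<close>, where \<open>\<phi> (e k)\<close> is close to \<open>\<phi> 0\<close>; so \<open>\<phi> (e k) (u k) \<rightarrow> w\<close>, and \<open>\<psi> (e k)\<close> maps these points to
  \<open>u k \<rightarrow> z\<close>. That identifies the limit of the normal sequence \<open>\<psi> (e k)\<close>.\<close>
lemma inverse_branch_limit:
  assumes S: "open S" "connected S" "D 0 \<subseteq> S" and E: "0 \<in> E" "range e \<subseteq> E" "e \<longlonglongrightarrow> 0"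
    and rep: "\<And>\<epsilon>. \<epsilon> \<in> E \<Longrightarrow> generalised_Cantor_repeller J (Dj \<epsilon>) (D \<epsilon>) (\<phi> \<epsilon>)"
    and D0: "\<And>\<epsilon>. \<epsilon> \<in> E \<Longrightarrow> 0 \<in> D \<epsilon>" and j: "j \<in> J"
    and conv: "domains_converge E (\<lambda>\<epsilon>. Dj \<epsilon> j)"
    and unif: "\<And>\<eta>. \<eta> > 0 \<Longrightarrow> \<forall>\<^sub>F \<epsilon> in at 0 within E. \<forall>z\<in>Dj \<epsilon> j \<inter> Dj 0 j. dist (\<phi> \<epsilon> z) (\<phi> 0 z) < \<eta>"
    and hol: "\<And>\<epsilon>. \<epsilon> \<in> E \<Longrightarrow> \<psi> \<epsilon> holomorphic_on S"
    and inverse: "\<And>\<epsilon> w. \<epsilon> \<in> E \<Longrightarrow> w \<in> D \<epsilon> \<Longrightarrow> \<psi> \<epsilon> w = inv_into (Dj \<epsilon> j) (\<phi> \<epsilon>) w"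
    and bounded: "\<And>Q. compact Q \<Longrightarrow> Q \<subseteq> S \<Longrightarrow> \<exists>B. \<forall>k. \<forall>z\<in>Q. norm (\<psi> (e k) z) \<le> B"
    and x: "x \<longlonglongrightarrow> x0" "x0 \<in> D 0"
  shows "(\<lambda>k. \<psi> (e k) (x k)) \<longlonglongrightarrow> \<psi> 0 x0 \<and> (\<lambda>k. deriv (\<psi> (e k)) (x k)) \<longlonglongrightarrow> deriv (\<psi> 0) x0"
proof -
  have ek: "e k \<in> E" for k using E by auto
  have Dj: "open (Dj \<epsilon> j)" "\<phi> \<epsilon> holomorphic_on Dj \<epsilon> j" "bij_betw (\<phi> \<epsilon>) (Dj \<epsilon> j) (D \<epsilon>)" "open (D \<epsilon>)" if "\<epsilon> \<in> E" for \<epsilon>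
    using rep[OF that] j
    unfolding generalised_Cantor_repeller_def topological_disc_def biholomorphic_onto_def by auto
  have ne: "Dj \<epsilon> j \<noteq> {}" if "\<epsilon> \<in> E" for \<epsilon> using Dj(3)[OF that] D0[OF that] by (auto simp: bij_betw_def)
  have "\<exists>u. u \<longlonglongrightarrow> w \<and> (\<lambda>k. \<psi> (e k) (u k)) \<longlonglongrightarrow> \<psi> 0 w" if w: "w \<in> D 0" for w
  proof -
    define z where "z = \<psi> 0 w"
    have z: "z \<in> Dj 0 j" "\<phi> 0 z = w"
      using repeller_inverse_branch(1,3)[OF rep[OF E(1)] j inverse[OF E(1)] w] unfolding z_def by auto
    obtain u where u: "\<And>k. u k \<in> Dj (e k) j" "u \<longlonglongrightarrow> z"
      using domains_converge_approximating_sequence[OF conv ne E z(1)] by auto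
    have v: "\<phi> (e k) (u k) \<in> D (e k)" "\<psi> (e k) (\<phi> (e k) (u k)) = u k" for k
    proof -
      show "\<phi> (e k) (u k) \<in> D (e k)" using Dj(3)[OF ek] u(1)[of k] by (auto simp: bij_betw_def)
      then show "\<psi> (e k) (\<phi> (e k) (u k)) = u k"
        using inverse[OF ek] Dj(3)[OF ek, of k] u(1)[of k] by (simp add: bij_betw_def)
    qed
    have uD: "\<forall>\<^sub>F k in sequentially. u k \<in> Dj 0 j"
      by (rule topological_tendstoD[OF u(2) Dj(1)[OF E(1)] z(1)])
    have "(\<lambda>k. dist (\<phi> (e k) (u k)) (\<phi> 0 (u k))) \<longlonglongrightarrow> 0"
    proof (rule tendstoI)
      fix \<eta> :: real assume \<eta>: "\<eta> > 0"
      obtain \<rho> where \<rho>: "\<rho> > 0" "\<And>\<epsilon>. \<epsilon> \<in> E \<Longrightarrow> norm \<epsilon> < \<rho> \<Longrightarrow> \<forall>z\<in>Dj \<epsilon> j \<inter> Dj 0 j. dist (\<phi> \<epsilon> z) (\<phi> 0 z) < \<eta>"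
        using eventually_at_0_within_ball[OF unif[OF \<eta>]] \<eta> by auto
      have "\<forall>\<^sub>F k in sequentially. norm (e k) < \<rho>" using tendstoD[OF E(3) \<rho>(1)] by simp
      with uD show "\<forall>\<^sub>F k in sequentially. dist (dist (\<phi> (e k) (u k)) (\<phi> 0 (u k))) 0 < \<eta>"
        by eventually_elim (use \<rho>(2)[OF ek] u(1) in auto)
    qed
    moreover have "(\<lambda>k. \<phi> 0 (u k)) \<longlonglongrightarrow> \<phi> 0 z"
      using holomorphic_on_imp_continuous_on[OF Dj(2)[OF E(1)]] u(2) z(1) uD by (rule continuous_on_tendsto_compose)
    ultimately have "(\<lambda>k. \<phi> (e k) (u k)) \<longlonglongrightarrow> w"
      unfolding z(2) using Lim_transform[of "\<lambda>k. \<phi> 0 (u k)" w sequentially "\<lambda>k. \<phi> (e k) (u k)"]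
      by (simp add: dist_norm tendsto_norm_zero_iff)
    then show ?thesis using u(2) v(2) z_def by (intro exI[of _ "\<lambda>k. \<phi> (e k) (u k)"]) simp
  qed
  then have "uniform_limit Q (\<lambda>k. \<psi> (e k)) (\<psi> 0) sequentially" if "compact Q" "Q \<subseteq> S" for Q
    using that D0[OF E(1)]
    by (intro normal_sequence_convergence[OF S(1,2) hol[OF ek] hol[OF E(1)] bounded Dj(4)[OF E(1)] _ S(3)]) auto
  from holomorphic_limit_at_moving_point[OF S(1) hol[OF ek] hol[OF E(1)] this x(1)]
  show ?thesis using x(2) S(3) by blast
qed

section \<open>Continuity of the pressure\<close>

text \<open>
  For small \<open>\<epsilon>\<close> the domains \<open>D \<epsilon>\<close> lie in one compact neighbourhood \<open>K\<close> of \<open>closure (D 0)\<close> in the extension disc and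
  each of them contains, besides \<open>0\<close>, a point \<open>q\<close> with \<open>\<bar>q\<bar> \<ge> R\<close>. These two facts give all the uniform
  constants: the distortion bound \<open>M\<close> on \<open>K\<close>, and the comparison of \<open>\<bar>\<psi>'\<bar>\<close> with the diameter of
  the branch domain, which contains both \<open>\<psi> 0\<close> and \<open>\<psi> q\<close>.\<close>
theorem lemma6p1:
  fixes E :: "complex set" and J :: "nat set"
    and Dj :: "complex \<Rightarrow> nat \<Rightarrow> complex set" and D :: "complex \<Rightarrow> complex set"
    and \<phi> :: "complex \<Rightarrow> complex \<Rightarrow> complex" and Dhat :: "complex set"
  defines "U \<equiv> \<lambda>\<epsilon>. \<Union>j\<in>J. Dj \<epsilon> j"
  assumes "0 \<in> E"
    and "\<forall>\<epsilon>\<in>E. generalised_Cantor_repeller J (Dj \<epsilon>) (D \<epsilon>) (\<phi> \<epsilon>)"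
    and "\<forall>\<epsilon>\<in>E. 0 \<in> D \<epsilon>"
    and "convergent_family E J Dj D \<phi>"
    and "uniform_exponential_tails E J Dj D"
    and "topological_disc Dhat" and "compactly_contained (D 0) Dhat"
    and "\<forall>\<epsilon>\<in>E. extensible_over J (Dj \<epsilon>) (D \<epsilon>) (\<phi> \<epsilon>) Dhat"
  shows "\<exists>\<delta>>0. \<forall>\<eta>>0. \<exists>\<rho>>0. \<forall>\<epsilon>\<in>E. norm \<epsilon> < \<rho> \<longrightarrow>
           (\<forall>t::real. \<bar>t - 1\<bar> < \<delta> \<longrightarrow>
              convergent (pressure_seq (U \<epsilon>) (\<phi> \<epsilon>) t) \<and>
              \<bar>pressure (U \<epsilon>) (\<phi> \<epsilon>) t - pressure (U 0) (\<phi> 0) t\<bar> < ereal \<eta>)"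
proof -
  note E0 = assms(2)
  have rep: "generalised_Cantor_repeller J (Dj \<epsilon>) (D \<epsilon>) (\<phi> \<epsilon>)" and zero: "0 \<in> D \<epsilon>"
    and ext: "extensible_over J (Dj \<epsilon>) (D \<epsilon>) (\<phi> \<epsilon>) Dhat" if "\<epsilon> \<in> E" for \<epsilon> using assms(3,4,9) that by auto
  have S: "open Dhat" "connected Dhat"
    using assms(7) homeomorphic_connectedness unfolding topological_disc_def by (auto simp: convex_connected)
  have openD: "open (D \<epsilon>)" if "\<epsilon> \<in> E" for \<epsilon>
    using rep[OF that] unfolding generalised_Cantor_repeller_def topological_disc_def by auto
  have Dj: "bounded (Dj \<epsilon> j)" "Dj \<epsilon> j \<subseteq> D \<epsilon>" if "\<epsilon> \<in> E" "j \<in> J" for \<epsilon> j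
    using rep[OF that(1)] that(2) closure_subset[of "Dj \<epsilon> j"]
    unfolding generalised_Cantor_repeller_def compactly_contained_def
    by (auto intro: bounded_subset[OF compact_imp_bounded])
  have convD: "domains_converge E D"
    and small: "(\<lambda>j0. SUP (\<epsilon>, j)\<in>E \<times> {j\<in>J. j \<ge> j0}. ennreal (diameter (Dj \<epsilon> j))) \<longlonglongrightarrow> 0"
    and convDj: "\<And>j. j \<in> J \<Longrightarrow> domains_converge E (\<lambda>\<epsilon>. Dj \<epsilon> j)"
    and unif: "\<And>j \<eta>. j \<in> J \<Longrightarrow> \<eta> > 0 \<Longrightarrow>
       \<forall>\<^sub>F \<epsilon> in at 0 within E. \<forall>z\<in>Dj \<epsilon> j \<inter> Dj 0 j. dist (\<phi> \<epsilon> z) (\<phi> 0 z) < \<eta>"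
    using assms(5) unfolding convergent_family_def by auto
  obtain C \<kappa> where C: "C > 0" and \<kappa>: "\<kappa> > 0" and
    tails: "\<And>\<epsilon> s. \<epsilon> \<in> E \<Longrightarrow> (\<Sum>\<^sub>\<infinity>j\<in>{j\<in>J. diameter (Dj \<epsilon> j) < exp (- s)}. ennreal (diameter (Dj \<epsilon> j)))
          < ennreal (C * exp (- s * \<kappa>))"
    using assms(6) unfolding uniform_exponential_tails_def by blast
  have "\<forall>\<epsilon>\<in>E. \<forall>j\<in>J. \<exists>f. f holomorphic_on Dhat \<and> inj_on f Dhat \<and> f ` Dhat \<subseteq> Dhat \<and>
      (\<forall>w\<in>D \<epsilon>. f w = inv_into (Dj \<epsilon> j) (\<phi> \<epsilon>) w)"
    using ext unfolding extensible_over_def by blast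
  then obtain \<psi> where "\<And>\<epsilon> j. \<epsilon> \<in> E \<Longrightarrow> j \<in> J \<Longrightarrow> \<psi> \<epsilon> j holomorphic_on Dhat \<and> inj_on (\<psi> \<epsilon> j) Dhat \<and>
      \<psi> \<epsilon> j ` Dhat \<subseteq> Dhat \<and> (\<forall>w\<in>D \<epsilon>. \<psi> \<epsilon> j w = inv_into (Dj \<epsilon> j) (\<phi> \<epsilon>) w)"
    by metis
  then have \<psi>: "\<psi> \<epsilon> j holomorphic_on Dhat" "inj_on (\<psi> \<epsilon> j) Dhat" "\<psi> \<epsilon> j ` Dhat \<subseteq> Dhat"
    and inverse: "\<And>w. w \<in> D \<epsilon> \<Longrightarrow> \<psi> \<epsilon> j w = inv_into (Dj \<epsilon> j) (\<phi> \<epsilon>) w" if "\<epsilon> \<in> E" "j \<in> J" for \<epsilon> j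
    using that by blast+
  have \<psi>_Dj: "\<psi> \<epsilon> j x \<in> Dj \<epsilon> j" if "\<epsilon> \<in> E" "j \<in> J" "x \<in> D \<epsilon>" for \<epsilon> j x
    using repeller_inverse_branch(1)[OF rep[OF that(1)] that(2) inverse[OF that(1,2)] that(3)] .
  obtain d where d: "d > 0" "(\<Union>x\<in>closure (D 0). cball x d) \<subseteq> Dhat"
    using compact_subset_open_imp_cball_epsilon_subset[of "closure (D 0)" Dhat] assms(8) S(1)
    unfolding compactly_contained_def by blast
  define K where "K = {x. infdist x (closure (D 0)) \<le> d}"
  have D0_ne: "closure (D 0) \<noteq> {}" using zero[OF E0] by auto
  have K: "compact K"
    unfolding K_def using D0_ne assms(8) d(1) by (intro compact_infdist_le) (auto simp: compactly_contained_def)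
  have KS: "K \<subseteq> Dhat"
  proof
    fix x assume "x \<in> K"
    moreover obtain y where "y \<in> closure (D 0)" "infdist x (closure (D 0)) = dist x y"
      using infdist_attains_inf[OF closed_closure D0_ne] by blast
    ultimately have "y \<in> closure (D 0)" "x \<in> cball y d" unfolding K_def by (auto simp: dist_commute)
    then show "x \<in> Dhat" using d(2) by blast
  qed
  obtain R where R: "R > 0" "cball 0 (2 * R) \<subseteq> D 0"
  proof -
    obtain R' where "R' > 0" "cball 0 R' \<subseteq> D 0" using openD[OF E0] zero[OF E0] open_contains_cball by blast
    then show ?thesis by (intro that[of "R' / 2"]) auto
  qed
  \<comment> \<open>A point of \<open>D 0\<close> that keeps distance \<open>R\<close> from \<open>0\<close> under perturbations smaller than \<open>R\<close>.\<close>
  define p where "p = complex_of_real (2 * R)"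
  have p: "p \<in> D 0" "norm p = 2 * R" using R unfolding p_def by auto
  have "min d R > 0" using d R by simp
  from domains_convergeD[OF convD _ E0 this] zero
  obtain \<rho>0 where \<rho>0: "\<rho>0 > 0" "\<And>\<epsilon> x. \<epsilon> \<in> E \<Longrightarrow> norm \<epsilon> < \<rho>0 \<Longrightarrow> x \<in> D \<epsilon> \<Longrightarrow> infdist x (closure (D 0)) < min d R"
     "\<And>\<epsilon>. \<epsilon> \<in> E \<Longrightarrow> norm \<epsilon> < \<rho>0 \<Longrightarrow> \<exists>x\<in>D \<epsilon>. dist p x < min d R" using p(1) by blast
  define E' where "E' = {\<epsilon>\<in>E. norm \<epsilon> < \<rho>0}"
  have E': "\<epsilon> \<in> E" "D \<epsilon> \<subseteq> K" if "\<epsilon> \<in> E'" for \<epsilon>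
    using that \<rho>0(2) unfolding E'_def K_def by force+
  have far: "\<exists>q\<in>D \<epsilon>. R \<le> norm q" if \<epsilon>: "\<epsilon> \<in> E'" for \<epsilon>
  proof -
    obtain q where q: "q \<in> D \<epsilon>" "dist p q < R" using \<rho>0(3)[of \<epsilon>] \<epsilon> unfolding E'_def by auto
    then have "norm q \<ge> R" using norm_triangle_ineq2[of p q] p(2) by (simp add: dist_norm)
    with q show ?thesis by auto
  qed
  obtain M where M: "M \<ge> 1" "\<And>f x y. f holomorphic_on Dhat \<Longrightarrow> inj_on f Dhat \<Longrightarrow> x \<in> K \<Longrightarrow> y \<in> K \<Longrightarrow>
      norm (deriv f x) \<le> M * norm (deriv f y)"
    using univalent_distortion_compact[OF S K KS] by blast
  have "D 0 \<subseteq> Dhat" using assms(8) closure_subset unfolding compactly_contained_def by blast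
  moreover have "ball (0::complex) R \<subseteq> cball 0 (2 * R)" using R(1) by auto
  ultimately have "ball 0 R \<subseteq> Dhat" using R(2) by blast
  from univalent_deriv_le_displacement[OF this R(1)]
  obtain C1 where C1: "C1 > 0" "\<And>f q. f holomorphic_on Dhat \<Longrightarrow> inj_on f Dhat \<Longrightarrow> q \<in> Dhat - ball 0 R \<Longrightarrow>
      norm (deriv f 0) \<le> C1 * norm (f q - f 0)" by blast
  define c where "c = max 1 (M * C1)"
  define L where "L = max 1 (diameter K)"
  have deriv_le: "norm (deriv (\<psi> \<epsilon> j) x) \<le> c * diameter (Dj \<epsilon> j)" if \<epsilon>: "\<epsilon> \<in> E'" and j: "j \<in> J" and x: "x \<in> D \<epsilon>" for \<epsilon> j x
  proof -
    note \<epsilon>E = E'(1)[OF \<epsilon>]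
    obtain q where q: "q \<in> D \<epsilon>" "R \<le> norm q" using far[OF \<epsilon>] by auto
    have "norm (deriv (\<psi> \<epsilon> j) x) \<le> M * norm (deriv (\<psi> \<epsilon> j) 0)"
      using M(2) \<psi>[OF \<epsilon>E j] E'(2)[OF \<epsilon>] x zero[OF \<epsilon>E] by blast
    also have "norm (deriv (\<psi> \<epsilon> j) 0) \<le> C1 * norm (\<psi> \<epsilon> j q - \<psi> \<epsilon> j 0)"
      using C1(2) \<psi>[OF \<epsilon>E j] q E'(2)[OF \<epsilon>] KS by auto
    also have "norm (\<psi> \<epsilon> j q - \<psi> \<epsilon> j 0) \<le> diameter (Dj \<epsilon> j)"
      unfolding dist_norm[symmetric]
      by (intro diameter_bounded_bound Dj(1)[OF \<epsilon>E j] \<psi>_Dj[OF \<epsilon>E j] q zero[OF \<epsilon>E])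
    finally have "norm (deriv (\<psi> \<epsilon> j) x) \<le> M * (C1 * diameter (Dj \<epsilon> j))"
      using M(1) C1(1) by (simp add: mult_left_mono)
    also have "\<dots> \<le> c * diameter (Dj \<epsilon> j)"
      unfolding c_def mult.assoc[symmetric] by (intro mult_right_mono diameter_ge_0 Dj(1)[OF \<epsilon>E j]) auto
    finally show ?thesis .
  qed
  have diam_le: "diameter (Dj \<epsilon> j) \<le> L" if "\<epsilon> \<in> E'" "j \<in> J" for \<epsilon> j
    using diameter_subset[of "Dj \<epsilon> j" K] Dj(2)[OF E'(1)[OF that(1)] that(2)] E'(2)[OF that(1)] compact_imp_bounded[OF K]
    unfolding L_def by fastforce
  interpret repeller_family E' J Dj D \<phi> Dhat \<psi> "\<lambda>\<epsilon> j. diameter (Dj \<epsilon> j)" M c C \<kappa> L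
  proof
    show "0 \<in> E'" using E0 \<rho>0(1) unfolding E'_def by simp
    show "open Dhat" "M \<ge> 1" "\<kappa> > 0" "C \<ge> 0" using S M(1) \<kappa> C by auto
    show "1 \<le> c" "1 \<le> L" unfolding c_def L_def by auto
    show "\<exists>N. \<forall>\<epsilon>\<in>E'. \<forall>j\<in>J. N \<le> j \<longrightarrow> diameter (Dj \<epsilon> j) < \<eta>" if "\<eta> > 0" for \<eta>
    proof -
      have "\<forall>\<^sub>F j0 in sequentially. (SUP (\<epsilon>, j)\<in>E \<times> {j\<in>J. j \<ge> j0}. ennreal (diameter (Dj \<epsilon> j))) < ennreal \<eta>"
        by (rule order_tendstoD(2)[OF small]) (use that in simp)
      then obtain N where N: "(SUP (\<epsilon>, j)\<in>E \<times> {j\<in>J. j \<ge> N}. ennreal (diameter (Dj \<epsilon> j))) < ennreal \<eta>"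
        by (auto simp: eventually_sequentially)
      have "diameter (Dj \<epsilon> j) < \<eta>" if "\<epsilon> \<in> E'" "j \<in> J" "N \<le> j" for \<epsilon> j
      proof -
        have "ennreal (diameter (Dj \<epsilon> j)) \<le> (SUP (\<epsilon>, j)\<in>E \<times> {j\<in>J. j \<ge> N}. ennreal (diameter (Dj \<epsilon> j)))"
          using that E' by (intro SUP_upper2[of "(\<epsilon>, j)"]) auto
        also note N
        finally show ?thesis using diameter_ge_0[OF Dj(1)[OF E'(1)[OF that(1)] that(2)]] by (simp add: ennreal_less_iff)
      qed
      then show ?thesis by blast
    qed
    show "(\<integral>\<^sup>+j. ennreal (diameter (Dj \<epsilon> j)) \<partial>count_space {j\<in>J. diameter (Dj \<epsilon> j) < exp (- s)}) \<le> ennreal (C * exp (- s * \<kappa>))"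
      if "\<epsilon> \<in> E'" for \<epsilon> s
      using tails[OF E'(1)[OF that], of s] by (subst (asm) infsum_ennreal_eq_nn_integral) auto
    fix e u x0 j assume e: "range e \<subseteq> E'" "e \<longlonglongrightarrow> 0" and j: "j \<in> J" and u: "u \<longlonglongrightarrow> x0" "x0 \<in> D 0"
    have ek: "e k \<in> E'" for k using e(1) by auto
    show "(\<lambda>k. \<psi> (e k) j (u k)) \<longlonglongrightarrow> \<psi> 0 j x0 \<and> (\<lambda>k. deriv (\<psi> (e k) j) (u k)) \<longlonglongrightarrow> deriv (\<psi> 0 j) x0"
    proof (rule inverse_branch_limit[where \<psi> = "\<lambda>\<epsilon>. \<psi> \<epsilon> j", OF S \<open>D 0 \<subseteq> Dhat\<close> E0 _ e(2) rep zero j convDj[OF j] unif[OF j] \<psi>(1) inverse _ u])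
      show "range e \<subseteq> E" using e(1) E' by auto
      \<comment> \<open>Local boundedness: \<open>\<psi> (e k) j 0\<close> stays in \<open>K\<close>, the derivative at \<open>0\<close> is bounded by the diameters,
          and distortion on \<open>Q \<union> K\<close> carries this over to \<open>Q\<close>.\<close>
      fix Q assume Q: "compact Q" "Q \<subseteq> Dhat"
      obtain M' where M': "M' \<ge> 1" "\<And>f x y. f holomorphic_on Dhat \<Longrightarrow> inj_on f Dhat \<Longrightarrow> x \<in> Q \<union> K \<Longrightarrow> y \<in> Q \<union> K \<Longrightarrow>
          norm (f x - f y) \<le> M' * norm (deriv f y)"
        using univalent_distortion_compact[OF S compact_Un[OF Q(1) K]] Q(2) KS by blast
      obtain B where B: "\<And>x. x \<in> K \<Longrightarrow> norm x \<le> B" using compact_imp_bounded[OF K] by (auto simp: bounded_iff)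
      show "\<exists>B. \<forall>k. \<forall>z\<in>Q. norm (\<psi> (e k) j z) \<le> B"
      proof (intro exI[of _ "M' * (c * L) + B"] allI ballI)
        fix k z assume z: "z \<in> Q"
        note kE = E'(1)[OF ek[of k]]
        have K0: "0 \<in> K" "\<psi> (e k) j 0 \<in> K"
          using zero[OF kE] \<psi>_Dj[OF kE j zero[OF kE]] Dj(2)[OF kE j] E'(2)[OF ek[of k]] by auto
        have "norm (deriv (\<psi> (e k) j) 0) \<le> c * diameter (Dj (e k) j)" by (rule deriv_le[OF ek j zero[OF kE]])
        also have "\<dots> \<le> c * L" using diam_le[OF ek j] by (intro mult_left_mono) (auto simp: c_def)
        finally have 1: "M' * norm (deriv (\<psi> (e k) j) 0) \<le> M' * (c * L)" using M'(1) by (intro mult_left_mono) auto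
        have 2: "norm (\<psi> (e k) j z - \<psi> (e k) j 0) \<le> M' * norm (deriv (\<psi> (e k) j) 0)"
          using M'(2)[OF \<psi>(1,2)[OF kE j]] z K0 by blast
        show "norm (\<psi> (e k) j z) \<le> M' * (c * L) + B"
          using norm_triangle_sub[of "\<psi> (e k) j z" "\<psi> (e k) j 0"] 1 2 B[OF K0(2)] by linarith
      qed
    qed (use j in auto)
  next
    fix \<epsilon> j x assume "\<epsilon> \<in> E'" "j \<in> J" "x \<in> D \<epsilon>"
    then show "norm (deriv (\<psi> \<epsilon> j) x) \<le> c * diameter (Dj \<epsilon> j)" by (rule deriv_le)
  next
    fix \<epsilon> j assume "\<epsilon> \<in> E'" "j \<in> J"
    then show "diameter (Dj \<epsilon> j) \<le> L" "0 \<le> diameter (Dj \<epsilon> j)"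
      by (rule diam_le, intro diameter_ge_0 Dj(1) E'(1))
  next
    fix \<epsilon> f x y assume "\<epsilon> \<in> E'" "f holomorphic_on Dhat" "inj_on f Dhat" "x \<in> D \<epsilon>" "y \<in> D \<epsilon>"
    then show "norm (deriv f x) \<le> M * norm (deriv f y)" using M(2) E'(2) by blast
  next
    fix \<epsilon> assume "\<epsilon> \<in> E'"
    then show "generalised_Cantor_repeller J (Dj \<epsilon>) (D \<epsilon>) (\<phi> \<epsilon>)" "0 \<in> D \<epsilon>" "D \<epsilon> \<subseteq> Dhat"
      using rep zero E' KS by blast+
  next
    fix \<epsilon> j assume "\<epsilon> \<in> E'" "j \<in> J"
    then show "\<psi> \<epsilon> j holomorphic_on Dhat" "inj_on (\<psi> \<epsilon> j) Dhat" "\<psi> \<epsilon> j ` Dhat \<subseteq> Dhat" using \<psi> E'(1) by blast+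
  next
    fix \<epsilon> j w assume "\<epsilon> \<in> E'" "j \<in> J" "w \<in> D \<epsilon>"
    then show "\<psi> \<epsilon> j w = inv_into (Dj \<epsilon> j) (\<phi> \<epsilon>) w" using inverse E'(1) by blast
  qed
  show ?thesis
  proof (rule exI[of _ "min (\<kappa> / 2) (1 / 2)"], intro conjI allI impI)
    show "min (\<kappa> / 2) (1 / 2) > 0" using \<kappa> by simp
    fix \<eta> :: real assume "\<eta> > 0"
    then obtain \<rho> where \<rho>: "\<rho> > 0" "\<And>\<epsilon> t. \<epsilon> \<in> E' \<Longrightarrow> norm \<epsilon> < \<rho> \<Longrightarrow> admissible t \<Longrightarrow> \<bar>P \<epsilon> t - P 0 t\<bar> < \<eta>"
      using pressure_uniform_limit by blast
    show "\<exists>\<rho>>0. \<forall>\<epsilon>\<in>E. norm \<epsilon> < \<rho> \<longrightarrow> (\<forall>t. \<bar>t - 1\<bar> < min (\<kappa> / 2) (1 / 2) \<longrightarrow>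
              convergent (pressure_seq (U \<epsilon>) (\<phi> \<epsilon>) t) \<and>
              \<bar>pressure (U \<epsilon>) (\<phi> \<epsilon>) t - pressure (U 0) (\<phi> 0) t\<bar> < ereal \<eta>)"
    proof (intro exI[of _ "min \<rho> \<rho>0"] conjI ballI allI impI)
      show "min \<rho> \<rho>0 > 0" using \<rho> \<rho>0 by simp
      fix \<epsilon> t assume \<epsilon>: "\<epsilon> \<in> E" "norm \<epsilon> < min \<rho> \<rho>0" and t: "\<bar>t - 1\<bar> < min (\<kappa> / 2) (1 / 2)"
      have t': "admissible t" using t unfolding admissible_def by simp
      have \<epsilon>': "\<epsilon> \<in> E'" using \<epsilon> unfolding E'_def by simp
      have lim: "pressure_seq (U \<epsilon>) (\<phi> \<epsilon>) t \<longlonglongrightarrow> ereal (P \<epsilon> t)" if "\<epsilon> \<in> E'" for \<epsilon>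
        unfolding U_def by (rule P_bounds(1)[OF that t'])
      show "convergent (pressure_seq (U \<epsilon>) (\<phi> \<epsilon>) t)" using lim[OF \<epsilon>'] by (rule convergentI)
      show "\<bar>pressure (U \<epsilon>) (\<phi> \<epsilon>) t - pressure (U 0) (\<phi> 0) t\<bar> < ereal \<eta>"
        unfolding pressure_def limI[OF lim[OF \<epsilon>']] limI[OF lim[OF zero_in_E]]
        using \<rho>(2)[OF \<epsilon>' _ t'] \<epsilon>(2) by simp
    qed
  qed
qed

end
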